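(* Let $G=G_1\cup G_2$ be a connected graph, where $G_1$ and $G_2$ are graphs such that $V(G_1)\cap V(G_2)=\{v\}$ and $v$ is a free vertex of both clique complexes $\Delta(G_1)$ and $\Delta(G_2)$. Then $J_G$ is unmixed if and only if $J_{G_1}$ and $J_{G_2}$ are both unmixed.
   Context: All graphs are finite and simple. $G_1\cup G_2$ is the graph with vertex set $V(G_1)\cup V(G_2)$ and edge set $E(G_1)\cup E(G_2)$. A clique of a graph is a set of pairwise adjacent vertices; the clique complex $\Delta(G)$ is the simplicial complex whose faces are the cliques of $G$, so its facets are the maximal cliques. A vertex is free in $\Delta(G)$ if it belongs to exactly one facet of $\Delta(G)$. Let $K$ be a field. The binomial edge ideal $J_G$ of a graph $G$ is the ideal of the polynomial ring $K[x_i,y_i: i\in V(G)]$ generated by the binomials $x_iy_j-x_jy_i$, where $\{i,j\}\in E(G)$ and $i<j$ (for a fixed total order on $V(G)$). An ideal is unmixed if all its associated primes have the same height (binomial edge ideals are radical, so these are the minimal primes). *)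

theory Defs
  imports
    "HOL-Algebra.Ideal"
    "HOL-Library.Extended_Nat"
    "HOL-Library.Poly_Mapping"
    "Graph_Theory.Digraph_Component"
begin

section \<open>Commutative algebra\<close>

definition height :: "('a, 'm) ring_scheme \<Rightarrow> 'a set \<Rightarrow> enat" where
  "height R P = Sup {enat n | n.
     \<exists>C :: nat \<Rightarrow> 'a set. (\<forall>i\<le>n. primeideal (C i) R) \<and> (\<forall>i<n. C i \<subset> C (Suc i)) \<and> C n = P}"

text \<open>The associated primes of \<open>I\<close> are those of the module \<open>R/I\<close>: the prime ideals that are
  annihilators of single elements of \<open>R/I\<close>.\<close>

definition associated_primes :: "('a, 'm) ring_scheme \<Rightarrow> 'a set \<Rightarrow> 'a set set" where
  "associated_primes R I =
     {P. primeideal P R \<and> (\<exists>f\<in>carrier R. P = {r \<in> carrier R. r \<otimes>\<^bsub>R\<^esub> f \<in> I})}"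

definition unmixed :: "('a, 'm) ring_scheme \<Rightarrow> 'a set \<Rightarrow> bool" where
  "unmixed R I \<longleftrightarrow>
     (\<forall>P\<in>associated_primes R I. \<forall>Q\<in>associated_primes R I. height R P = height R Q)"


section \<open>Polynomial rings\<close>

type_synonym ('x, 'k) mpoly = "('x \<Rightarrow>\<^sub>0 nat) \<Rightarrow>\<^sub>0 'k"

definition mvar :: "'x \<Rightarrow> ('x, 'k :: comm_ring_1) mpoly" where
  "mvar x = Poly_Mapping.single (Poly_Mapping.single x 1) 1"

text \<open>The ring \<open>k[A]\<close>: the variable set \<open>A\<close> is an argument because graphs with different vertex
  sets have different polynomial rings.\<close>

definition polynomial_ring :: "'x set \<Rightarrow> ('x, 'k :: comm_ring_1) mpoly ring" where
  "polynomial_ring A =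
     \<lparr>carrier = {p. \<forall>m\<in>Poly_Mapping.keys p. Poly_Mapping.keys m \<subseteq> A},
      monoid.mult = (*), one = 1, zero = 0, add = (+)\<rparr>"

lemma polynomial_ring_simps [simp]:
  "p \<in> carrier (polynomial_ring A) \<longleftrightarrow> (\<forall>m\<in>Poly_Mapping.keys p. Poly_Mapping.keys m \<subseteq> A)"
  "\<one>\<^bsub>polynomial_ring A\<^esub> = 1"
  "\<zero>\<^bsub>polynomial_ring A\<^esub> = 0"
  "p \<otimes>\<^bsub>polynomial_ring A\<^esub> q = p * q"
  "p \<oplus>\<^bsub>polynomial_ring A\<^esub> q = p + q"
  by (simp_all add: polynomial_ring_def)

lemma cring_polynomial_ring: "cring (polynomial_ring A :: ('x, 'k :: comm_ring_1) mpoly ring)"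
proof (rule cringI)
  let ?R = "polynomial_ring A :: ('x, 'k) mpoly ring"
  have add_closed: "p + q \<in> carrier ?R" if "p \<in> carrier ?R" "q \<in> carrier ?R" for p q
    using that Poly_Mapping.keys_add[of p q] unfolding polynomial_ring_simps by blast
  have mult_closed: "p * q \<in> carrier ?R" if pq: "p \<in> carrier ?R" "q \<in> carrier ?R" for p q
    unfolding polynomial_ring_simps
  proof
    fix m assume "m \<in> Poly_Mapping.keys (p * q)"
    then obtain a b where "a \<in> Poly_Mapping.keys p" "b \<in> Poly_Mapping.keys q" "m = a + b"
      using Poly_Mapping.keys_mult[of p q] by blast
    then show "Poly_Mapping.keys m \<subseteq> A"
      using pq Poly_Mapping.keys_add[of a b] unfolding polynomial_ring_simps by blast
  qed
  show "abelian_group ?R"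
  proof (rule abelian_groupI)
    fix p assume "p \<in> carrier ?R"
    then have "- p \<in> carrier ?R" by (simp add: in_keys_iff)
    then show "\<exists>q\<in>carrier ?R. q \<oplus>\<^bsub>?R\<^esub> p = \<zero>\<^bsub>?R\<^esub>"
      by (rule rev_bexI) simp
  next
    fix p q assume "p \<in> carrier ?R" "q \<in> carrier ?R"
    then show "p \<oplus>\<^bsub>?R\<^esub> q \<in> carrier ?R"
      using add_closed by (simp only: polynomial_ring_simps(5))
  qed (simp_all only: polynomial_ring_simps, simp_all add: add.assoc add.commute)
  show "comm_monoid ?R"
  proof (rule comm_monoidI)
    fix p q assume "p \<in> carrier ?R" "q \<in> carrier ?R"
    then show "p \<otimes>\<^bsub>?R\<^esub> q \<in> carrier ?R"
      using mult_closed by (simp only: polynomial_ring_simps(4))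
  qed (simp_all only: polynomial_ring_simps, simp_all add: mult.assoc mult.commute)
qed (simp only: polynomial_ring_simps distrib_right)


section \<open>Clique complexes\<close>

text \<open>Finite simple graphs are the \<open>pair_graph\<close>s of the graph library: symmetric, irreflexive arc
  relations on a finite vertex set.\<close>

definition clique_complex :: "'v pair_pre_digraph \<Rightarrow> 'v set set" where
  "clique_complex G = {F. F \<subseteq> pverts G \<and> (\<forall>u\<in>F. \<forall>w\<in>F. u \<noteq> w \<longrightarrow> (u, w) \<in> parcs G)}"

definition facets :: "'v set set \<Rightarrow> 'v set set" where
  "facets \<Delta> = {F \<in> \<Delta>. \<forall>F'\<in>\<Delta>. F \<subseteq> F' \<longrightarrow> F = F'}"

definition free_vertex :: "'v set set \<Rightarrow> 'v \<Rightarrow> bool" where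
  "free_vertex \<Delta> v \<longleftrightarrow> (\<exists>!F. F \<in> facets \<Delta> \<and> v \<in> F)"


section \<open>Binomial edge ideals\<close>

datatype 'v edge_var = XVar 'v | YVar 'v

text \<open>The fixed total order on the vertices is the one of the linearly ordered vertex type.\<close>

definition edge_ring :: "'v pair_pre_digraph \<Rightarrow> ('v edge_var, 'k :: field) mpoly ring" where
  "edge_ring G = polynomial_ring (XVar ` pverts G \<union> YVar ` pverts G)"

definition binomial_edge_ideal ::
    "('v :: linorder) pair_pre_digraph \<Rightarrow> ('v edge_var, 'k :: field) mpoly set" where
  "binomial_edge_ideal G = Idl\<^bsub>edge_ring G\<^esub>
     {mvar (XVar i) * mvar (YVar j) - mvar (XVar j) * mvar (YVar i) | i j. (i, j) \<in> parcs G \<and> i < j}"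

end

theory Submission
  imports Defs "HOL-Library.Product_Lexorder"
begin

text \<open>The idea is to describe the associated primes of \<open>J\<^sub>G\<close> and their heights by removing vertices from the
  graph, which turns unmixedness into a count of components, and then to see how components
  behave when two graphs are glued at a free vertex.

  For a set \<open>S\<close> of vertices let \<open>P\<^sub>S\<close> be the kernel of the map that sends \<open>x\<^sub>i, y\<^sub>i\<close> to \<open>0\<close> for \<open>i \<in> S\<close> and
  to \<open>a\<^sub>i u\<^sub>c, a\<^sub>i w\<^sub>c\<close> for \<open>i\<close> in the component \<open>c\<close> of \<open>G - S\<close> (\<open>component_prime\<close>). It is prime because the
  target is a polynomial ring over a field.

  Its height is \<open>|S| + |V| - c(S)\<close>, where \<open>c(S)\<close> is the number of components of \<open>G - S\<close>
  (\<open>height_block_prime\<close>). From below, this is a chain of primes of the same kind: first the variables of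
  \<open>S\<close> are killed one at a time, then blocks of vertices are merged. From above, an element of a
  prime that is not in a smaller prime enlarges any family that is algebraically independent modulo the
  bigger one (\<open>indep_mod_extend\<close>), and a polynomial ring in \<open>N\<close> variables over a field contains at most \<open>N\<close>
  algebraically independent elements (\<open>indep_mod_le_card\<close>).

  The ideal \<open>J\<^sub>G\<close> is the intersection of all \<open>P\<^sub>S\<close> (\<open>edge_ideal_eq_Inter\<close>). If adjacency is transitive, then \<open>G\<close> is a
  disjoint union of cliques and \<open>J\<^sub>G\<close> is the kernel itself, since every monomial can be straightened by
  swaps \<open>x\<^sub>i y\<^sub>j \<leadsto> x\<^sub>j y\<^sub>i\<close>. Otherwise some vertex \<open>v\<close> has two non-adjacent neighbours, and \<open>J\<^sub>G\<close> is the
  intersection of the ideals of two simpler configurations: the graph in which the neighbours of \<open>v\<close> are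
  made adjacent, and the graph without \<open>v\<close>, with \<open>x\<^sub>v\<close> and \<open>y\<^sub>v\<close> added to the ideal. The
  reason is that \<open>x\<^sub>v\<close> and \<open>y\<^sub>v\<close> multiply the new binomials into \<open>J\<^sub>G\<close>: for \<open>p\<close> in the first ideal the part of \<open>p\<close>
  that involves \<open>x\<^sub>v\<close> or \<open>y\<^sub>v\<close> is in \<open>J\<^sub>G\<close>, and for \<open>p\<close> in the second ideal the remaining part is.

  The associated primes of a finite intersection of primes are its minimal members, and \<open>P\<^sub>S\<close> is
  minimal iff \<open>S\<close> is a cut set: every \<open>i \<in> S\<close> has two neighbours in different components of \<open>G - S\<close>
  (\<open>associated_primes_edge_ideal\<close>). The empty set is a cut set, so for connected \<open>G\<close> unmixedness means
  \<open>c(S) = |S| + 1\<close> for all cut sets \<open>S\<close> (\<open>unmixed_edge_ideal_iff\<close>).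

  Finally let \<open>G = G\<^sub>1 \<union> G\<^sub>2\<close> be glued at \<open>v\<close>. The neighbours of a free vertex form a clique, so \<open>v\<close> is in no
  cut set of \<open>G\<^sub>1\<close> or \<open>G\<^sub>2\<close>, and removing \<open>v\<close> from \<open>G\<^sub>1\<close> or \<open>G\<^sub>2\<close> disconnects nothing. A cut set of \<open>G\<^sub>1\<close> is a cut set
  of \<open>G\<close>; conversely a cut set \<open>S\<close> of \<open>G\<close> gives the cut sets \<open>S \<inter> V\<^sub>i - {v}\<close> of \<open>G\<^sub>i\<close>. If \<open>v \<notin> S\<close>, one component of
  \<open>G\<^sub>1 - S\<close> and one of \<open>G\<^sub>2 - S\<close> are merged; if \<open>v \<in> S\<close>, none are, but then \<open>v\<close> is an additional element of \<open>S\<close>.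
  In both cases the equations \<open>c(S) = |S| + 1\<close> for \<open>G\<^sub>1\<close> and \<open>G\<^sub>2\<close> add up to the one for \<open>G\<close>
  (\<open>balanced_gluing_iff\<close>).\<close>

section \<open>Substitution homomorphisms of polynomial rings\<close>

definition cst :: "'k \<Rightarrow> ('x, 'k :: comm_ring_1) mpoly" where
  "cst c = Poly_Mapping.single 0 c"

text \<open>The carrier of \<open>k[A]\<close> as a set in the type of all polynomials: its ring operations are those of the
  type, so computations can avoid the ring record.\<close>

definition Pol :: "'x set \<Rightarrow> ('x, 'k :: comm_ring_1) mpoly set" where
  "Pol A = {p. \<forall>m\<in>Poly_Mapping.keys p. Poly_Mapping.keys m \<subseteq> A}"

definition monomial_value :: "('x \<Rightarrow> 'r) \<Rightarrow> ('x \<Rightarrow>\<^sub>0 nat) \<Rightarrow> 'r :: comm_ring_1" where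
  "monomial_value g m = (\<Prod>x\<in>Poly_Mapping.keys m. g x ^ Poly_Mapping.lookup m x)"

definition subst :: "('x \<Rightarrow> ('y, 'k) mpoly) \<Rightarrow> ('x, 'k :: comm_ring_1) mpoly \<Rightarrow> ('y, 'k) mpoly" where
  "subst g p = (\<Sum>m\<in>Poly_Mapping.keys p. cst (Poly_Mapping.lookup p m) * monomial_value g m)"

lemma carrier_polynomial_ring: "carrier (polynomial_ring A) = Pol A"
  by (auto simp: polynomial_ring_def Pol_def)

lemma mpoly_induct [case_names zero plus]:
  assumes "P 0"
    and "\<And>m c p. m \<notin> Poly_Mapping.keys p \<Longrightarrow> c \<noteq> 0 \<Longrightarrow> P p \<Longrightarrow> P (Poly_Mapping.single m c + p)"
  shows "P (p :: 'a \<Rightarrow>\<^sub>0 'b :: cancel_comm_monoid_add)"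
proof (induction "card (Poly_Mapping.keys p)" arbitrary: p)
  case 0
  then show ?case using assms(1) by simp
next
  case (Suc n)
  then obtain m where m: "m \<in> Poly_Mapping.keys p"
    by (metis card.empty equals0I nat.distinct(1))
  define q where "q = p - Poly_Mapping.single m (Poly_Mapping.lookup p m)"
  have keys: "Poly_Mapping.keys q = Poly_Mapping.keys p - {m}"
    by (auto simp: q_def in_keys_iff lookup_minus lookup_single when_def split: if_splits)
  then have "card (Poly_Mapping.keys q) = n"
    using Suc(2) m by simp
  then have "P q" using Suc(1) by simp
  then have "P (Poly_Mapping.single m (Poly_Mapping.lookup p m) + q)"
    using keys m by (intro assms(2)) (auto simp: in_keys_iff)
  moreover have "Poly_Mapping.single m (Poly_Mapping.lookup p m) + q = p"
    by (intro poly_mapping_eqI) (auto simp: q_def lookup_add lookup_minus lookup_single when_def)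
  ultimately show ?case by simp
qed

lemma keys_single_add:
  fixes p :: "'a \<Rightarrow>\<^sub>0 'b :: comm_monoid_add"
  assumes "m \<notin> Poly_Mapping.keys p" "c \<noteq> 0"
  shows "Poly_Mapping.keys (Poly_Mapping.single m c + p) = insert m (Poly_Mapping.keys p)"
  using assms by (auto simp: in_keys_iff lookup_add lookup_single when_def split: if_splits)

lemma keys_plus_nat: "Poly_Mapping.keys (m + n :: 'x \<Rightarrow>\<^sub>0 nat) = Poly_Mapping.keys m \<union> Poly_Mapping.keys n"
  by (auto simp: in_keys_iff lookup_add)

lemma cst_simps [simp]:
  "cst 0 = 0" "cst 1 = 1" "cst (a + b) = cst a + cst b" "cst (a * b) = cst a * cst b"
  by (simp_all add: cst_def single_add mult_single)

lemma single_eq_cst_times: "Poly_Mapping.single m c = cst c * Poly_Mapping.single m 1"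
  by (simp add: cst_def mult_single)

lemma monomial_value_superset:
  assumes "finite B" "Poly_Mapping.keys m \<subseteq> B"
  shows "monomial_value g m = (\<Prod>x\<in>B. g x ^ Poly_Mapping.lookup m x)"
  unfolding monomial_value_def using assms
  by (intro prod.mono_neutral_left) (auto simp: in_keys_iff)

lemma monomial_value_0 [simp]: "monomial_value g 0 = 1"
  by (simp add: monomial_value_def)

lemma monomial_value_add: "monomial_value g (m + n) = monomial_value g m * monomial_value g n"
proof -
  let ?B = "Poly_Mapping.keys m \<union> Poly_Mapping.keys n"
  have "monomial_value g k = (\<Prod>x\<in>?B. g x ^ Poly_Mapping.lookup k x)"
    if "Poly_Mapping.keys k \<subseteq> ?B" for k
    using that by (intro monomial_value_superset) auto
  then show ?thesis
    by (simp add: keys_plus_nat lookup_add power_add prod.distrib)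
qed

lemma monomial_value_variable [simp]: "monomial_value g (Poly_Mapping.single x (Suc 0)) = g x"
  by (simp add: monomial_value_def)

lemma monomial_value_mvar:
  "monomial_value (mvar :: 'x \<Rightarrow> ('x, 'k :: comm_ring_1) mpoly) m = Poly_Mapping.single m 1"
proof (induction m rule: mpoly_induct)
  case (plus x n m)
  have "(mvar x :: ('x, 'k) mpoly) ^ n = Poly_Mapping.single (Poly_Mapping.single x n) 1" for n :: nat
  proof (induction n)
    case (Suc n)
    have "Poly_Mapping.single x (Suc n) = Poly_Mapping.single x (Suc 0) + Poly_Mapping.single x n"
      using single_add[of x 1 n] by simp
    then show ?case using Suc by (simp add: mvar_def mult_single)
  qed simp
  then have "monomial_value (mvar :: 'x \<Rightarrow> ('x, 'k) mpoly) (Poly_Mapping.single x n) = Poly_Mapping.single (Poly_Mapping.single x n) 1"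
    using plus by (simp add: monomial_value_def)
  then show ?case using plus by (simp add: monomial_value_add mult_single)
qed simp

lemma subst_superset:
  assumes "finite B" "Poly_Mapping.keys p \<subseteq> B"
  shows "subst g p = (\<Sum>m\<in>B. cst (Poly_Mapping.lookup p m) * monomial_value g m)"
  unfolding subst_def using assms
  by (intro sum.mono_neutral_left) (auto simp: in_keys_iff)

lemma subst_0 [simp]: "subst g 0 = 0"
  by (simp add: subst_def)

lemma subst_single: "subst g (Poly_Mapping.single m c) = cst c * monomial_value g m"
  by (cases "c = 0") (simp_all add: subst_def)

lemma subst_1 [simp]: "subst g 1 = 1"
  using subst_single[of g 0 1] by simp

lemma subst_cst [simp]: "subst g (cst c) = cst c"
  by (simp add: cst_def subst_single)

lemma subst_mvar [simp]: "subst g (mvar x) = g x"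
  by (simp add: mvar_def subst_single)

lemma subst_add [simp]: "subst g (p + q) = subst g p + subst g q"
proof -
  let ?B = "Poly_Mapping.keys p \<union> Poly_Mapping.keys q"
  have "subst g r = (\<Sum>m\<in>?B. cst (Poly_Mapping.lookup r m) * monomial_value g m)"
    if "Poly_Mapping.keys r \<subseteq> ?B" for r
    using that by (intro subst_superset) auto
  then show ?thesis
    using Poly_Mapping.keys_add[of p q] by (simp add: lookup_add distrib_right sum.distrib)
qed

lemma subst_uminus [simp]: "subst g (- p) = - subst g p"
  using subst_add[of g p "- p"] by (simp add: add_eq_0_iff)

lemma subst_diff [simp]: "subst g (p - q) = subst g p - subst g q"
  using subst_add[of g p "- q"] by simp

lemma subst_mult [simp]: "subst g (p * q) = subst g p * subst g q"
proof -
  have single: "subst g (Poly_Mapping.single m c * q) = subst g (Poly_Mapping.single m c) * subst g q" for m c q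
    by (induction q rule: mpoly_induct)
      (simp_all add: mult_single distrib_left subst_single monomial_value_add algebra_simps)
  show ?thesis
    by (induction p rule: mpoly_induct) (simp_all add: single distrib_right)
qed

lemma subst_power [simp]: "subst g (p ^ n) = subst g p ^ n"
  by (induction n) simp_all

lemma subst_prod: "subst g (prod f B) = (\<Prod>x\<in>B. subst g (f x))"
  by (induction B rule: infinite_finite_induct) simp_all

lemma subst_sum: "subst g (sum f B) = (\<Sum>x\<in>B. subst g (f x))"
  by (induction B rule: infinite_finite_induct) simp_all

lemma subst_subst: "subst h (subst g p) = subst (\<lambda>x. subst h (g x)) p"
proof (induction p rule: mpoly_induct)
  case (plus m c p)
  then show ?case
    by (simp add: subst_single) (simp add: monomial_value_def subst_prod)
qed simp

lemma subst_cong: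
  assumes "p \<in> Pol A" "\<And>x. x \<in> A \<Longrightarrow> g x = h x"
  shows "subst g p = subst h p"
  unfolding subst_def monomial_value_def
proof (intro sum.cong arg_cong2[where f = "(*)"] prod.cong refl arg_cong2[where f = "(^)"])
  fix m x assume "m \<in> Poly_Mapping.keys p" "x \<in> Poly_Mapping.keys m"
  then show "g x = h x" using assms by (auto simp: Pol_def)
qed

lemma Pol_intros [simp, intro]:
  "0 \<in> Pol A" "1 \<in> Pol A" "cst c \<in> Pol A" "x \<in> A \<Longrightarrow> mvar x \<in> Pol A"
  by (auto simp: Pol_def cst_def mvar_def in_keys_iff lookup_single when_def split: if_splits)

lemma Pol_single: "Poly_Mapping.keys m \<subseteq> A \<Longrightarrow> Poly_Mapping.single m c \<in> Pol A"
  by (auto simp: Pol_def in_keys_iff lookup_single when_def split: if_splits)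

lemma Pol_add [simp, intro]: "p \<in> Pol A \<Longrightarrow> q \<in> Pol A \<Longrightarrow> p + q \<in> Pol A"
  using Poly_Mapping.keys_add[of p q] by (fastforce simp: Pol_def)

lemma Pol_uminus [simp, intro]: "p \<in> Pol A \<Longrightarrow> - p \<in> Pol A"
  by (auto simp: Pol_def in_keys_iff)

lemma Pol_diff [simp, intro]: "p \<in> Pol A \<Longrightarrow> q \<in> Pol A \<Longrightarrow> p - q \<in> Pol A"
  using Pol_add[of p A "- q"] by simp

lemma Pol_mult [simp, intro]:
  assumes "p \<in> Pol A" "q \<in> Pol A" shows "p * q \<in> Pol A"
  unfolding Pol_def
proof safe
  fix m x assume "m \<in> Poly_Mapping.keys (p * q)" "x \<in> Poly_Mapping.keys m"
  then obtain a b where "a \<in> Poly_Mapping.keys p" "b \<in> Poly_Mapping.keys q" "m = a + b"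
    using Poly_Mapping.keys_mult[of p q] by blast
  then show "x \<in> A"
    using assms \<open>x \<in> Poly_Mapping.keys m\<close> unfolding Pol_def by (auto simp: keys_plus_nat)
qed

lemma Pol_power [simp, intro]: "p \<in> Pol A \<Longrightarrow> p ^ n \<in> Pol A"
  by (induction n) auto

lemma Pol_prod: "(\<And>x. x \<in> B \<Longrightarrow> f x \<in> Pol A) \<Longrightarrow> prod f B \<in> Pol A"
  by (induction B rule: infinite_finite_induct) auto

lemma Pol_sum: "(\<And>x. x \<in> B \<Longrightarrow> f x \<in> Pol A) \<Longrightarrow> sum f B \<in> Pol A"
  by (induction B rule: infinite_finite_induct) auto

lemma Pol_subst:
  assumes "p \<in> Pol A" "\<And>x. x \<in> A \<Longrightarrow> g x \<in> Pol B"
  shows "subst g p \<in> Pol B"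
  unfolding subst_def monomial_value_def
proof (intro Pol_sum Pol_mult Pol_prod Pol_power Pol_intros)
  fix m x assume "m \<in> Poly_Mapping.keys p" "x \<in> Poly_Mapping.keys m"
  then have "x \<in> A" using assms(1) by (auto simp: Pol_def)
  then show "g x \<in> Pol B" by (rule assms(2))
qed

text \<open>Division with remainder by a variable, the remainder being the value at \<open>x = 0\<close>. The statement
  about exponents says that the quotient involves no new variables and that its degree in \<open>x\<close> is
  smaller, as inductions on that degree require.\<close>

lemma split_variable:
  fixes p :: "('x, 'k :: comm_ring_1) mpoly"
  shows "\<exists>q. p = subst (mvar(x := 0)) p + mvar x * q \<and>
    (\<forall>m\<in>Poly_Mapping.keys q. m + Poly_Mapping.single x 1 \<in> Poly_Mapping.keys p)"
proof (induction p rule: mpoly_induct)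
  case zero
  then show ?case by (intro exI[of _ 0]) simp
next
  case (plus m c p)
  then obtain q where q: "p = subst (mvar(x := 0)) p + mvar x * q"
    "\<And>m. m \<in> Poly_Mapping.keys q \<Longrightarrow> m + Poly_Mapping.single x 1 \<in> Poly_Mapping.keys p"
    by blast
  note keys = keys_single_add[OF plus(1,2)]
  show ?case
  proof (cases "x \<in> Poly_Mapping.keys m")
    case False
    have "monomial_value (mvar(x := 0 :: ('x, 'k) mpoly)) m = monomial_value mvar m"
      unfolding monomial_value_def using False by (intro prod.cong) auto
    then have "subst (mvar(x := 0)) (Poly_Mapping.single m c) = Poly_Mapping.single m c"
      by (simp add: subst_single monomial_value_mvar flip: single_eq_cst_times)
    then have "Poly_Mapping.single m c + p = subst (mvar(x := 0)) (Poly_Mapping.single m c + p) + mvar x * q"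
      unfolding subst_add by (metis add.assoc q(1))
    moreover have "n + Poly_Mapping.single x 1 \<in> Poly_Mapping.keys (Poly_Mapping.single m c + p)"
      if "n \<in> Poly_Mapping.keys q" for n
      using that q(2) keys by simp
    ultimately show ?thesis by blast
  next
    case True
    define m' where "m' = m - Poly_Mapping.single x 1"
    have m: "m = m' + Poly_Mapping.single x 1"
      using True by (intro poly_mapping_eqI)
        (auto simp: m'_def lookup_add lookup_minus lookup_single when_def in_keys_iff)
    have 1: "subst (mvar(x := 0)) (Poly_Mapping.single m c) = 0"
      by (simp add: subst_single m monomial_value_add)
    have 2: "Poly_Mapping.single m c = mvar x * Poly_Mapping.single m' c"
      by (simp add: mvar_def mult_single m add.commute)
    have "Poly_Mapping.keys (Poly_Mapping.single m' c + q) \<subseteq> insert m' (Poly_Mapping.keys q)"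
      using Poly_Mapping.keys_add[of "Poly_Mapping.single m' c" q] by (auto split: if_splits)
    then have "n + Poly_Mapping.single x 1 \<in> Poly_Mapping.keys (Poly_Mapping.single m c + p)"
      if "n \<in> Poly_Mapping.keys (Poly_Mapping.single m' c + q)" for n
      using that q(2) keys m by auto
    moreover have "Poly_Mapping.single m c + p = subst (mvar(x := 0)) (Poly_Mapping.single m c + p)
        + mvar x * (Poly_Mapping.single m' c + q)"
      unfolding subst_add 1 distrib_left 2[symmetric] by (metis add.left_commute add_0 q(1))
    ultimately show ?thesis by blast
  qed
qed

definition ker :: "'x set \<Rightarrow> ('x \<Rightarrow> ('y, 'k) mpoly) \<Rightarrow> ('x, 'k :: comm_ring_1) mpoly set" where
  "ker A g = {p \<in> Pol A. subst g p = 0}"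

text \<open>Negation is multiplication by \<open>- 1\<close>, so additive closure and absorption make a subgroup.\<close>

lemma ideal_polynomial_ringI:
  fixes I :: "('x, 'k :: comm_ring_1) mpoly set"
  assumes "I \<subseteq> Pol A" "0 \<in> I" and add: "\<And>p q. p \<in> I \<Longrightarrow> q \<in> I \<Longrightarrow> p + q \<in> I"
    and mult: "\<And>p q. p \<in> I \<Longrightarrow> q \<in> Pol A \<Longrightarrow> q * p \<in> I"
  shows "ideal I (polynomial_ring A)"
proof -
  interpret cring "polynomial_ring A :: ('x, 'k) mpoly ring" by (rule cring_polynomial_ring)
  have minus: "inv\<^bsub>add_monoid (polynomial_ring A)\<^esub> p = - p" if "p \<in> Pol A" for p :: "('x, 'k) mpoly"
    unfolding a_inv_def[symmetric]
  proof (rule minus_equality)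
    show "- p \<oplus>\<^bsub>polynomial_ring A\<^esub> p = \<zero>\<^bsub>polynomial_ring A\<^esub>"
      by (simp only: polynomial_ring_simps) simp
  qed (use that in \<open>simp_all only: carrier_polynomial_ring, simp_all\<close>)
  show ?thesis
  proof (rule idealI[OF ring_axioms])
    show "subgroup I (add_monoid (polynomial_ring A))"
    proof (rule group.subgroupI[OF a_group])
      fix p assume "p \<in> I"
      moreover from this have "- 1 * p \<in> I" using assms(1) by (intro mult) auto
      ultimately show "inv\<^bsub>add_monoid (polynomial_ring A)\<^esub> p \<in> I" using assms(1) minus by auto
    qed (use assms in \<open>auto simp: carrier_polynomial_ring simp del: polynomial_ring_simps(1)\<close>)
  qed (use mult in \<open>auto simp: carrier_polynomial_ring mult.commute simp del: polynomial_ring_simps(1)\<close>)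
qed

text \<open>The linear order on the target variables orders the monomials, which makes the target an integral
  domain.\<close>

lemma prime_ker:
  fixes g :: "'x \<Rightarrow> ('y :: linorder, 'k :: field) mpoly"
  shows "primeideal (ker A g) (polynomial_ring A)"
proof (rule primeidealI)
  show "ideal (ker A g) (polynomial_ring A)"
    by (rule ideal_polynomial_ringI) (auto simp: ker_def)
  show "carrier (polynomial_ring A) \<noteq> ker A g"
    unfolding carrier_polynomial_ring by (auto simp: ker_def set_eq_iff intro!: exI[of _ 1])
qed (auto simp: ker_def carrier_polynomial_ring cring_polynomial_ring simp del: polynomial_ring_simps(1))

text \<open>The substitution \<open>g'\<close> factors through \<open>g\<close>. All inclusions between kernels below arise in this way.\<close>

lemma ker_mono:
  assumes "\<And>x. x \<in> A \<Longrightarrow> subst h (g x) = g' x"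
  shows "ker A g \<subseteq> ker A g'"
proof
  fix p assume p: "p \<in> ker A g"
  have "subst g' p = subst (\<lambda>x. subst h (g x)) p"
    using p assms by (intro subst_cong[of p A]) (auto simp: ker_def)
  also have "\<dots> = 0" using p by (simp add: ker_def flip: subst_subst)
  finally show "p \<in> ker A g'" using p by (simp add: ker_def)
qed

section \<open>Kernels of monomial maps\<close>

text \<open>The action of the substitution \<open>x \<mapsto> X\<^bsup>a x\<^esup>\<close> on exponent vectors.\<close>

definition exponent_map :: "('x \<Rightarrow> 'y \<Rightarrow>\<^sub>0 nat) \<Rightarrow> ('x \<Rightarrow>\<^sub>0 nat) \<Rightarrow> ('y \<Rightarrow>\<^sub>0 nat)" where
  "exponent_map a m = (\<Sum>x\<in>Poly_Mapping.keys m. \<Sum>_<Poly_Mapping.lookup m x. a x)"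

lemma lookup_exponent_map:
  "Poly_Mapping.lookup (exponent_map a m) y =
     (\<Sum>x\<in>Poly_Mapping.keys m. Poly_Mapping.lookup m x * Poly_Mapping.lookup (a x) y)"
  by (simp add: exponent_map_def lookup_sum)

lemma exponent_map_add: "exponent_map a (m + n) = exponent_map a m + exponent_map a n"
proof (rule poly_mapping_eqI)
  fix y
  let ?B = "Poly_Mapping.keys m \<union> Poly_Mapping.keys n"
  have "Poly_Mapping.lookup (exponent_map a k) y =
      (\<Sum>x\<in>?B. Poly_Mapping.lookup k x * Poly_Mapping.lookup (a x) y)"
    if "Poly_Mapping.keys k \<subseteq> ?B" for k
    unfolding lookup_exponent_map using that by (intro sum.mono_neutral_left) (auto simp: in_keys_iff)
  then show "Poly_Mapping.lookup (exponent_map a (m + n)) y =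
      Poly_Mapping.lookup (exponent_map a m + exponent_map a n) y"
    by (simp add: lookup_add keys_plus_nat distrib_right sum.distrib)
qed

lemma exponent_map_variable: "exponent_map a (Poly_Mapping.single x (Suc 0)) = a x"
  by (simp add: exponent_map_def)

lemma single_sum_one:
  "Poly_Mapping.single (\<Sum>i\<in>I. e i) (1 :: 'k :: comm_ring_1) = (\<Prod>i\<in>I. Poly_Mapping.single (e i :: 'y \<Rightarrow>\<^sub>0 nat) 1)"
proof (induction I rule: infinite_finite_induct)
  case (insert x F)
  then show ?case using mult_single[of "e x" "1 :: 'k" "sum e F" 1] by simp
qed simp_all

lemma monomial_value_monomials:
  "monomial_value (\<lambda>x. if x \<in> Z then 0 else Poly_Mapping.single (a x) 1) m =
    (if Poly_Mapping.keys m \<inter> Z = {} then Poly_Mapping.single (exponent_map a m) (1 :: 'k :: comm_ring_1) else 0)"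
proof (cases "Poly_Mapping.keys m \<inter> Z = {}")
  case True
  then show ?thesis
    by (auto simp: monomial_value_def exponent_map_def single_sum_one intro!: prod.cong)
next
  case False
  then obtain x where "x \<in> Poly_Mapping.keys m" "x \<in> Z" by blast
  then show ?thesis
    by (auto simp: monomial_value_def in_keys_iff zero_power intro!: prod_zero bexI[of _ x])
qed

text \<open>A polynomial in the kernel of a monomial map is a sum of monomials that are killed and of
  differences of monomials with equal images: among the terms with a given non-zero image the
  coefficients sum to zero, so a term can be moved to another term of the same fibre, which shortens the
  polynomial.\<close>

lemma monomial_kernel_induct:
  fixes p :: "('x, 'k :: comm_ring_1) mpoly" and I :: "('x, 'k) mpoly set"
  assumes p: "subst (\<lambda>x. if x \<in> Z then 0 else Poly_Mapping.single (a x) 1) p = 0"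
    and K: "Poly_Mapping.keys p \<subseteq> K"
    and zero: "0 \<in> I" and add: "\<And>p q. p \<in> I \<Longrightarrow> q \<in> I \<Longrightarrow> p + q \<in> I"
    and killed: "\<And>m c. m \<in> K \<Longrightarrow> Poly_Mapping.keys m \<inter> Z \<noteq> {} \<Longrightarrow> Poly_Mapping.single m c \<in> I"
    and fibre: "\<And>m n c. m \<in> K \<Longrightarrow> n \<in> K \<Longrightarrow> Poly_Mapping.keys m \<inter> Z = {} \<Longrightarrow>
      Poly_Mapping.keys n \<inter> Z = {} \<Longrightarrow> exponent_map a m = exponent_map a n \<Longrightarrow>
      Poly_Mapping.single m c - Poly_Mapping.single n c \<in> I"
  shows "p \<in> I"
  using p K
proof (induction "card (Poly_Mapping.keys p)" arbitrary: p rule: less_induct)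
  case less
  let ?g = "\<lambda>x. if x \<in> Z then 0 else Poly_Mapping.single (a x) (1 :: 'k)"
  show ?case
  proof (cases "p = 0")
    case True
    then show ?thesis using zero by simp
  next
    case False
    then obtain m where m: "m \<in> Poly_Mapping.keys p" by fastforce
    define c where "c = Poly_Mapping.lookup p m"
    have c: "c \<noteq> 0" using m by (simp add: c_def in_keys_iff)
    have step: "p \<in> I" if d: "d \<in> I" and sd: "subst ?g d = 0" and
      kd: "Poly_Mapping.keys (p - d) \<subseteq> Poly_Mapping.keys p - {m}" for d
    proof -
      have "card (Poly_Mapping.keys (p - d)) < card (Poly_Mapping.keys p)"
        using kd m by (intro psubset_card_mono) auto
      then have "p - d \<in> I" using less.prems sd kd by (intro less.hyps) auto
      then show ?thesis using add[OF _ d] by fastforce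
    qed
    show ?thesis
    proof (cases "Poly_Mapping.keys m \<inter> Z = {}")
      case killed_m: False
      show ?thesis
      proof (rule step[of "Poly_Mapping.single m c"])
        show "Poly_Mapping.single m c \<in> I" using killed[of m] m less.prems killed_m by auto
        show "subst ?g (Poly_Mapping.single m c) = 0"
          using killed_m by (simp add: subst_single monomial_value_monomials)
      qed (auto simp: c_def in_keys_iff lookup_minus lookup_single when_def split: if_splits)
    next
      case True
      \<comment> \<open>Otherwise the image of \<open>m\<close> would occur in the image of \<open>p\<close> with coefficient \<open>c \<noteq> 0\<close>.\<close>
      have "\<exists>n\<in>Poly_Mapping.keys p. n \<noteq> m \<and> Poly_Mapping.keys n \<inter> Z = {} \<and> exponent_map a n = exponent_map a m"
      proof (rule ccontr)
        assume none: "\<not> ?thesis"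
        have "Poly_Mapping.lookup (subst ?g p) (exponent_map a m) =
          (\<Sum>n\<in>Poly_Mapping.keys p. if n = m then c else 0)"
          unfolding subst_def lookup_sum
        proof (intro sum.cong refl)
          fix n assume "n \<in> Poly_Mapping.keys p"
          then show "Poly_Mapping.lookup (cst (Poly_Mapping.lookup p n) * monomial_value ?g n) (exponent_map a m)
            = (if n = m then c else 0)"
            using none True
            by (auto simp: monomial_value_monomials c_def lookup_single when_def simp flip: single_eq_cst_times)
        qed
        then show False using less.prems c m by simp
      qed
      then obtain n where n: "n \<in> Poly_Mapping.keys p" "n \<noteq> m" "Poly_Mapping.keys n \<inter> Z = {}"
        "exponent_map a n = exponent_map a m" by blast
      show ?thesis
      proof (rule step[of "Poly_Mapping.single m c - Poly_Mapping.single n c"])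
        show "Poly_Mapping.single m c - Poly_Mapping.single n c \<in> I"
          using n True m less.prems by (intro fibre) auto
        show "subst ?g (Poly_Mapping.single m c - Poly_Mapping.single n c) = 0"
          using n True by (simp add: subst_single monomial_value_monomials)
      qed (use n m in \<open>auto simp: c_def in_keys_iff lookup_minus lookup_single when_def split: if_splits\<close>)
    qed
  qed
qed

lemma monomial_map_injective:
  fixes p :: "('x, 'k :: comm_ring_1) mpoly"
  assumes "subst (\<lambda>x. Poly_Mapping.single (a x) 1) p = 0" "p \<in> Pol B"
    and "inj_on (exponent_map a) {m. Poly_Mapping.keys m \<subseteq> B}"
  shows "p = 0"
proof -
  have "p \<in> {0}"
  proof (rule monomial_kernel_induct[where Z = "{}" and a = a and K = "{m. Poly_Mapping.keys m \<subseteq> B}"])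
    fix m n c assume "m \<in> {m. Poly_Mapping.keys m \<subseteq> B}" "n \<in> {m. Poly_Mapping.keys m \<subseteq> B}"
      "exponent_map a m = exponent_map a n"
    then have "m = n" using assms(3) by (simp add: inj_on_def)
    then show "Poly_Mapping.single m c - Poly_Mapping.single n c \<in> {0}" by simp
  qed (use assms in \<open>auto simp: Pol_def\<close>)
  then show ?thesis by simp
qed

section \<open>Heights of primes from algebraic independence\<close>

definition prime_chain :: "('a, 'm) ring_scheme \<Rightarrow> nat \<Rightarrow> (nat \<Rightarrow> 'a set) \<Rightarrow> bool" where
  "prime_chain R n C \<longleftrightarrow> (\<forall>i\<le>n. primeideal (C i) R) \<and> (\<forall>i<n. C i \<subset> C (Suc i))"

text \<open>Algebraic independence of \<open>t 0, \<dots>, t (d - 1)\<close> modulo \<open>P\<close>. The new variables are natural numbers, so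
  that a family can be prolonged by one element.\<close>

definition indep_mod :: "nat \<Rightarrow> (nat \<Rightarrow> ('x, 'k) mpoly) \<Rightarrow> ('x, 'k :: comm_ring_1) mpoly set \<Rightarrow> bool" where
  "indep_mod d t P \<longleftrightarrow> (\<forall>q\<in>Pol {..<d}. subst t q \<in> P \<longrightarrow> q = 0)"

lemma ideal_polynomial_ringD:
  fixes I :: "('x, 'k :: comm_ring_1) mpoly set"
  assumes "ideal I (polynomial_ring A)"
  shows "I \<subseteq> Pol A" "0 \<in> I" "p \<in> I \<Longrightarrow> q \<in> I \<Longrightarrow> p + q \<in> I"
    "p \<in> I \<Longrightarrow> q \<in> Pol A \<Longrightarrow> q * p \<in> I" "p \<in> I \<Longrightarrow> - p \<in> I" "p \<in> I \<Longrightarrow> q \<in> I \<Longrightarrow> p - q \<in> I"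
proof -
  interpret ideal I "polynomial_ring A" by fact
  show sub: "I \<subseteq> Pol A"
    using a_subset unfolding carrier_polynomial_ring .
  show "0 \<in> I"
    using additive_subgroup.zero_closed[OF is_additive_subgroup] by simp
  show add: "p + q \<in> I" if "p \<in> I" "q \<in> I" for p q
    using additive_subgroup.a_closed[OF is_additive_subgroup that] by simp
  show mult: "q * p \<in> I" if "p \<in> I" "q \<in> Pol A" for p q
    using I_l_closed[of p q] that by (simp add: carrier_polynomial_ring del: polynomial_ring_simps(1))
  show uminus: "- p \<in> I" if "p \<in> I" for p
    using mult[of p "- 1"] that by simp
  show "p - q \<in> I" if "p \<in> I" "q \<in> I" for p q
    using add[of p "- q"] uminus[of q] that by simp
qed

lemma prime_polynomial_ringD:
  fixes P :: "('x, 'k :: comm_ring_1) mpoly set"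
  assumes "primeideal P (polynomial_ring A)"
  shows "ideal P (polynomial_ring A)" "1 \<notin> P"
    "p \<in> Pol A \<Longrightarrow> q \<in> Pol A \<Longrightarrow> p * q \<in> P \<Longrightarrow> p \<in> P \<or> q \<in> P"
proof -
  interpret primeideal P "polynomial_ring A" by fact
  show *: "ideal P (polynomial_ring A)" by (rule is_ideal)
  show "p \<in> P \<or> q \<in> P" if "p \<in> Pol A" "q \<in> Pol A" "p * q \<in> P"
    using I_prime[of p q] that by (simp add: carrier_polynomial_ring del: polynomial_ring_simps(1))
  show "1 \<notin> P"
  proof
    assume "1 \<in> P"
    then have "Pol A \<subseteq> P" using ideal_polynomial_ringD(4)[OF *, of 1] by auto
    then show False
      using I_notcarr ideal_polynomial_ringD(1)[OF *] by (auto simp: carrier_polynomial_ring)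
  qed
qed

text \<open>Passing to a smaller prime \<open>P\<close> raises the transcendence degree of the quotient. Take \<open>f\<close> in \<open>P'\<close> but not in
  \<open>P\<close>, and suppose that \<open>q\<close> is a relation modulo \<open>P\<close> between the family and \<open>f\<close>. Modulo \<open>P'\<close> the
  variable for \<open>f\<close> becomes zero, so what remains of \<open>q\<close> is a relation between the given elements and
  vanishes. Hence \<open>q\<close> is divisible by that variable, and since \<open>f \<notin> P\<close> the quotient is again a relation,
  of smaller degree in it.\<close>

lemma indep_mod_extend:
  fixes P P' :: "('x, 'k :: comm_ring_1) mpoly set"
  assumes P: "primeideal P (polynomial_ring A)" and P': "primeideal P' (polynomial_ring A)"
    and sub: "P \<subset> P'" and t: "\<And>i. i < d \<Longrightarrow> t i \<in> Pol A" and indep: "indep_mod d t P'"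
  shows "\<exists>f\<in>Pol A. indep_mod (Suc d) (t(d := f)) P"
proof -
  note iP = ideal_polynomial_ringD[OF prime_polynomial_ringD(1)[OF P]]
    and iP' = ideal_polynomial_ringD[OF prime_polynomial_ringD(1)[OF P']]
  obtain f where f: "f \<in> P'" "f \<notin> P" using sub by blast
  then have fA: "f \<in> Pol A" using iP'(1) by blast
  let ?t = "t(d := f)"
  have tA: "?t i \<in> Pol A" if "i < Suc d" for i
    using that t fA by (auto simp: less_Suc_eq)
  have "q = 0" if "q \<in> Pol {..<Suc d}" "subst ?t q \<in> P"
    "\<And>m. m \<in> Poly_Mapping.keys q \<Longrightarrow> Poly_Mapping.lookup m d < n" for q n
    using that
  proof (induction n arbitrary: q)
    case 0
    then have "Poly_Mapping.keys q = {}" by blast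
    then show ?case by simp
  next
    case (Suc n)
    define q0 where "q0 = subst (mvar(d := 0)) q"
    obtain q' where q': "q = q0 + mvar d * q'"
      "\<And>m. m \<in> Poly_Mapping.keys q' \<Longrightarrow> m + Poly_Mapping.single d 1 \<in> Poly_Mapping.keys q"
      using split_variable[of q d] unfolding q0_def by blast
    have q0: "q0 \<in> Pol {..<d}"
      unfolding q0_def by (rule Pol_subst[OF Suc.prems(1)]) (auto simp: less_Suc_eq)
    have q'_Pol: "q' \<in> Pol {..<Suc d}"
      unfolding Pol_def
    proof safe
      fix m x assume "m \<in> Poly_Mapping.keys q'" "x \<in> Poly_Mapping.keys m"
      then have "m + Poly_Mapping.single d 1 \<in> Poly_Mapping.keys q" "x \<in> Poly_Mapping.keys (m + Poly_Mapping.single d 1)"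
        using q'(2) by (auto simp: keys_plus_nat)
      then show "x < Suc d" using Suc.prems(1) by (auto simp: Pol_def)
    qed
    have s_q': "subst ?t q' \<in> Pol A"
      using q'_Pol tA by (rule Pol_subst) auto
    have s_q0: "subst ?t q0 = subst t q0"
      by (rule subst_cong[OF q0]) auto
    have s_q: "subst ?t q = subst t q0 + subst ?t q' * f"
      by (simp add: q'(1) s_q0 mult.commute)
    have "subst ?t q - subst ?t q' * f \<in> P'"
      using sub Suc.prems(2) f(1) s_q' by (intro iP'(4,6)) blast+
    then have "q0 = 0"
      using indep q0 by (auto simp: indep_mod_def s_q)
    then have "subst ?t q' \<in> P"
      using Suc.prems(2) f s_q s_q' fA prime_polynomial_ringD(3)[OF P, of "subst ?t q'" f]
      by (auto simp del: fun_upd_apply)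
    moreover have "Poly_Mapping.lookup m d < n" if "m \<in> Poly_Mapping.keys q'" for m
      using Suc.prems(3)[OF q'(2)[OF that]] by (simp add: lookup_add)
    ultimately have "q' = 0" using q'_Pol by (intro Suc.IH)
    then show ?case using q' \<open>q0 = 0\<close> by simp
  qed
  moreover have "\<exists>n. \<forall>m\<in>Poly_Mapping.keys q. Poly_Mapping.lookup m d < n" for q :: "(nat, 'k) mpoly"
    using finite_nat_set_iff_bounded[of "(\<lambda>m. Poly_Mapping.lookup m d) ` Poly_Mapping.keys q"] by auto
  ultimately have "indep_mod (Suc d) ?t P" unfolding indep_mod_def by meson
  then show ?thesis using fA by blast
qed

text \<open>Going down a chain of primes, each step contributes one more independent element.\<close>

lemma indep_mod_chain:
  fixes C :: "nat \<Rightarrow> ('x, 'k :: comm_ring_1) mpoly set"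
  assumes "prime_chain (polynomial_ring A) n C" "\<And>i. i < d \<Longrightarrow> t i \<in> Pol A" "indep_mod d t (C n)"
  shows "\<exists>t'. (\<forall>i<d + n. t' i \<in> Pol A) \<and> indep_mod (d + n) t' (C 0)"
  using assms
proof (induction n arbitrary: d t)
  case 0
  then show ?case by auto
next
  case (Suc n)
  obtain f where f: "f \<in> Pol A" "indep_mod (Suc d) (t(d := f)) (C n)"
    using indep_mod_extend[of "C n" A "C (Suc n)" d t] Suc.prems by (auto simp: prime_chain_def)
  have "\<exists>t'. (\<forall>i<Suc d + n. t' i \<in> Pol A) \<and> indep_mod (Suc d + n) t' (C 0)"
    using Suc.prems(1,2) f(1) f(2)[unfolded fun_upd_def]
    by (intro Suc.IH[of "Suc d" "t(d := f)"]) (auto simp: prime_chain_def less_Suc_eq)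
  then show ?case by simp
qed

definition bounded_exponents :: "'x set \<Rightarrow> nat \<Rightarrow> ('x \<Rightarrow>\<^sub>0 nat) set" where
  "bounded_exponents B k = {m. Poly_Mapping.keys m \<subseteq> B \<and> (\<forall>x. Poly_Mapping.lookup m x \<le> k)}"

lemma card_bounded_exponents:
  assumes "finite B"
  shows "finite (bounded_exponents B k)" "card (bounded_exponents B k) = (k + 1) ^ card B"
proof -
  have "bij_betw (\<lambda>m. restrict (Poly_Mapping.lookup m) B) (bounded_exponents B k) (B \<rightarrow>\<^sub>E {..k})"
  proof (rule bij_betw_byWitness[where f' = "\<lambda>f. \<Sum>x\<in>B. Poly_Mapping.single x (f x)"])
    show "\<forall>m\<in>bounded_exponents B k. (\<Sum>x\<in>B. Poly_Mapping.single x (restrict (Poly_Mapping.lookup m) B x)) = m"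
    proof
      fix m assume m: "m \<in> bounded_exponents B k"
      show "(\<Sum>x\<in>B. Poly_Mapping.single x (restrict (Poly_Mapping.lookup m) B x)) = m"
      proof (rule poly_mapping_eqI)
        fix y
        have "Poly_Mapping.lookup m y = 0" if "y \<notin> B"
          using that m by (auto simp: bounded_exponents_def in_keys_iff)
        then show "Poly_Mapping.lookup (\<Sum>x\<in>B. Poly_Mapping.single x (restrict (Poly_Mapping.lookup m) B x)) y = Poly_Mapping.lookup m y"
          using assms by (simp add: lookup_sum lookup_single when_def)
      qed
    qed
    have lk: "Poly_Mapping.lookup (\<Sum>x\<in>B. Poly_Mapping.single x (f x)) y = (if y \<in> B then f y else 0)" for f :: "'a \<Rightarrow> nat" and y
      using assms by (simp add: lookup_sum lookup_single when_def)
    show "\<forall>f\<in>B \<rightarrow>\<^sub>E {..k}. restrict (Poly_Mapping.lookup (\<Sum>x\<in>B. Poly_Mapping.single x (f x))) B = f"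
      by (auto simp: lk fun_eq_iff PiE_def extensional_def)
    show "(\<lambda>f. \<Sum>x\<in>B. Poly_Mapping.single x (f x)) ` (B \<rightarrow>\<^sub>E {..k}) \<subseteq> bounded_exponents B k"
      by (auto simp: bounded_exponents_def lk in_keys_iff split: if_splits)
    show "(\<lambda>m. restrict (Poly_Mapping.lookup m) B) ` bounded_exponents B k \<subseteq> B \<rightarrow>\<^sub>E {..k}"
      by (auto simp: bounded_exponents_def)
  qed
  then show "finite (bounded_exponents B k)" "card (bounded_exponents B k) = (k + 1) ^ card B"
    using assms by (auto simp: bij_betw_finite bij_betw_same_card card_PiE finite_PiE)
qed

text \<open>A bound for the degree in each variable separately; unlike for the total degree, the exponent vectors
  it allows form a box.\<close>

definition degree_at_most :: "nat \<Rightarrow> ('x, 'k :: comm_ring_1) mpoly \<Rightarrow> bool" where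
  "degree_at_most D p \<longleftrightarrow> (\<forall>m\<in>Poly_Mapping.keys p. \<forall>x. Poly_Mapping.lookup m x \<le> D)"

lemma degree_at_most_mult:
  assumes "degree_at_most D p" "degree_at_most E q"
  shows "degree_at_most (D + E) (p * q)"
  unfolding degree_at_most_def
proof safe
  fix m x assume "m \<in> Poly_Mapping.keys (p * q)"
  then obtain a b where "a \<in> Poly_Mapping.keys p" "b \<in> Poly_Mapping.keys q" "m = a + b"
    using Poly_Mapping.keys_mult[of p q] by blast
  then show "Poly_Mapping.lookup m x \<le> D + E"
    using assms by (auto simp: degree_at_most_def lookup_add intro: add_mono)
qed

lemma degree_at_most_1: "degree_at_most D 1"
  by (simp add: degree_at_most_def)

lemma degree_at_most_power: "degree_at_most D p \<Longrightarrow> degree_at_most (n * D) (p ^ n)"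
  by (induction n) (auto simp: degree_at_most_1 intro!: degree_at_most_mult)

lemma degree_at_most_prod:
  "(\<And>x. x \<in> B \<Longrightarrow> degree_at_most D (f x)) \<Longrightarrow> degree_at_most (card B * D) (prod f B)"
  by (induction B rule: infinite_finite_induct) (auto simp: degree_at_most_1 intro!: degree_at_most_mult)

lemma degree_at_most_mono: "degree_at_most D p \<Longrightarrow> D \<le> E \<Longrightarrow> degree_at_most E p"
  unfolding degree_at_most_def using le_trans by blast

lemma degree_at_most_exists:
  fixes t :: "nat \<Rightarrow> ('x, 'k :: comm_ring_1) mpoly"
  shows "\<exists>D. \<forall>i<M. degree_at_most D (t i)"
proof -
  have "\<exists>D. degree_at_most D p" for p :: "('x, 'k) mpoly"
  proof -
    let ?S = "\<Union>m\<in>Poly_Mapping.keys p. Poly_Mapping.lookup m ` Poly_Mapping.keys m"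
    have "finite ?S" by auto
    then obtain D where D: "\<And>n. n \<in> ?S \<Longrightarrow> n \<le> D"
      using finite_nat_set_iff_bounded_le[of ?S] by blast
    have "degree_at_most D p"
      unfolding degree_at_most_def
    proof safe
      fix m x assume "m \<in> Poly_Mapping.keys p"
      then show "Poly_Mapping.lookup m x \<le> D"
        using D[of "Poly_Mapping.lookup m x"]
        by (cases "x \<in> Poly_Mapping.keys m") (blast, simp add: in_keys_iff)
    qed
    then show ?thesis by blast
  qed
  then have "\<forall>i. \<exists>D. degree_at_most D (t i)" by blast
  then obtain d where d: "\<And>i. degree_at_most (d i) (t i)" using choice[of "\<lambda>i D. degree_at_most D (t i)"] by blast
  have "degree_at_most (Max (d ` {..<M})) (t i)" if "i < M" for i
    using that by (intro degree_at_most_mono[OF d]) auto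
  then show ?thesis by blast
qed

text \<open>A counting argument. If \<open>M\<close> elements of partial degrees at most \<open>D\<close> are independent, then their
  \<open>(k + 1)\<^sup>M\<close> monomials with exponents at most \<open>k\<close> are linearly independent, and they lie in the space
  spanned by the \<open>(M k D + 1)\<^sup>N\<close> monomials of partial degrees at most \<open>M k D\<close> in \<open>N\<close> variables. For \<open>M > N\<close> the
  first number outgrows the second as \<open>k\<close> increases.\<close>

lemma indep_mod_le_card:
  fixes t :: "nat \<Rightarrow> ('x, 'k :: field) mpoly"
  assumes A: "finite A" and t: "\<And>i. i < M \<Longrightarrow> t i \<in> Pol A" and indep: "indep_mod M t P" and "0 \<in> P"
  shows "M \<le> card A"
proof (rule ccontr)
  assume "\<not> M \<le> card A"
  then have M: "Suc (card A) \<le> M" by simp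
  interpret V: vector_space "\<lambda>c p. cst c * p :: ('x, 'k) mpoly"
    by unfold_locales (simp_all add: distrib_left distrib_right mult.assoc)
  obtain D where D: "\<And>i. i < M \<Longrightarrow> degree_at_most D (t i)"
    using degree_at_most_exists[of M t] by blast
  have inj: "q = 0" if "q \<in> Pol {..<M}" "subst t q = 0" for q
    using indep that \<open>0 \<in> P\<close> by (auto simp: indep_mod_def)
  have count: "(k + 1) ^ M \<le> (M * (k * D) + 1) ^ card A" for k
  proof -
    let ?E = "bounded_exponents {..<M} k" and ?F = "bounded_exponents A (M * (k * D))"
    let ?b = "monomial_value t"
    let ?T = "(\<lambda>m. Poly_Mapping.single m (1 :: 'k)) ` ?F"
    have E: "Poly_Mapping.keys m \<subseteq> {..<M}" if "m \<in> ?E" for m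
      using that by (simp add: bounded_exponents_def)
    have b: "?b m = subst t (Poly_Mapping.single m 1)" for m
      by (simp add: subst_single)
    have inj_b: "inj_on ?b ?E"
    proof (rule inj_onI)
      fix m n assume mn: "m \<in> ?E" "n \<in> ?E" "?b m = ?b n"
      then have "Poly_Mapping.single m (1 :: 'k) - Poly_Mapping.single n 1 = 0"
        by (intro inj) (auto simp: b intro!: Pol_diff Pol_single dest: E)
      then show "m = n"
        by (auto simp: poly_mapping_eq_iff fun_eq_iff lookup_minus lookup_single when_def split: if_splits)
    qed
    have "V.independent (?b ` ?E)"
    proof (rule V.independent_if_scalars_zero)
      show "finite (?b ` ?E)" using card_bounded_exponents(1) by blast
      fix u w assume 0: "(\<Sum>w\<in>?b ` ?E. cst (u w) * w) = 0" and "w \<in> ?b ` ?E"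
      then obtain m where m: "m \<in> ?E" "w = ?b m" by blast
      let ?q = "\<Sum>n\<in>?E. Poly_Mapping.single n (u (?b n))"
      have "subst t ?q = (\<Sum>n\<in>?E. cst (u (?b n)) * ?b n)"
        by (simp add: subst_sum subst_single)
      also have "\<dots> = 0" using 0 by (simp add: sum.reindex[OF inj_b])
      finally have "?q = 0" by (intro inj Pol_sum Pol_single) (auto dest: E)
      then have "Poly_Mapping.lookup ?q m = 0" by simp
      then show "u w = 0"
        using m card_bounded_exponents(1)[of "{..<M}" k]
        by (simp add: lookup_sum lookup_single when_def)
    qed
    moreover have "?b ` ?E \<subseteq> V.span ?T"
    proof safe
      fix m assume m: "m \<in> ?E"
      have "?b m \<in> Pol A"
        unfolding b using t E[OF m] by (intro Pol_subst[of _ "{..<M}"] Pol_single) auto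
      moreover have "degree_at_most (M * (k * D)) (?b m)"
      proof -
        have "degree_at_most (card {..<M} * (k * D)) (\<Prod>x<M. t x ^ Poly_Mapping.lookup m x)"
        proof (rule degree_at_most_prod)
          fix x assume "x \<in> {..<M}"
          then show "degree_at_most (k * D) (t x ^ Poly_Mapping.lookup m x)"
            using D m by (intro degree_at_most_mono[OF degree_at_most_power[of D]]) (auto simp: bounded_exponents_def)
        qed
        then show ?thesis using E[OF m] by (simp add: monomial_value_superset[of "{..<M}"])
      qed
      ultimately have "Poly_Mapping.keys (?b m) \<subseteq> ?F"
        by (auto simp: Pol_def degree_at_most_def bounded_exponents_def)
      moreover have "p \<in> V.span ?T" if "Poly_Mapping.keys p \<subseteq> ?F" for p :: "('x, 'k) mpoly"
        using that
      proof (induction p rule: mpoly_induct)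
        case (plus n c p)
        then have "cst c * Poly_Mapping.single n 1 + p \<in> V.span ?T"
          by (intro V.span_add V.span_scale[OF V.span_base]) (auto simp: keys_single_add)
        then show ?case by (simp flip: single_eq_cst_times)
      qed (simp add: V.span_zero)
      ultimately show "?b m \<in> V.span ?T" by blast
    qed
    moreover have "finite ?T" using card_bounded_exponents(1)[OF A] by blast
    ultimately have "card (?b ` ?E) \<le> card ?T" using V.independent_span_bound by blast
    also have "\<dots> \<le> card ?F" by (intro card_image_le card_bounded_exponents(1) A)
    finally show ?thesis
      by (simp add: card_image[OF inj_b] card_bounded_exponents A)
  qed
  \<comment> \<open>Large enough: \<open>k + 1\<close> exceeds the factor that is lost in \<open>(M k D + 1)\<^sup>N \<le> (k + 1)\<^sup>N (M D + 1)\<^sup>N\<close>.\<close>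
  define k where "k = (M * D + 1) ^ card A"
  have "(k + 1) ^ Suc (card A) \<le> (k + 1) ^ M"
    using M by (intro power_increasing) auto
  also have "\<dots> \<le> (M * (k * D) + 1) ^ card A" by (rule count)
  also have "\<dots> \<le> ((k + 1) * (M * D + 1)) ^ card A"
    by (intro power_mono) (auto simp: algebra_simps)
  also have "\<dots> = (k + 1) ^ card A * k" by (simp only: power_mult_distrib k_def)
  finally show False by simp
qed

text \<open>A chain of length \<open>h\<close> shows that the height is at least \<open>h\<close>. A longer chain would prolong \<open>d\<close> independent elements
  modulo \<open>P\<close> to more than \<open>card A\<close> independent polynomials.\<close>

lemma height_eqI:
  fixes P :: "('x, 'k :: field) mpoly set"
  assumes "finite A" and C: "prime_chain (polynomial_ring A) h C" "C h = P"
    and t: "\<And>i. i < d \<Longrightarrow> t i \<in> Pol A" "indep_mod d t P" and "card A \<le> d + h"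
  shows "height (polynomial_ring A) P = enat h"
proof -
  have "n \<le> h" if C': "prime_chain (polynomial_ring A) n C'" "C' n = P" for n C'
  proof -
    obtain t' where "\<forall>i<d + n. t' i \<in> Pol A" "indep_mod (d + n) t' (C' 0)"
      using indep_mod_chain[of A n C' d t] C' t by auto
    moreover have "0 \<in> C' 0"
      using C'(1) by (intro ideal_polynomial_ringD(2)[of _ A] prime_polynomial_ringD(1)) (auto simp: prime_chain_def)
    ultimately have "d + n \<le> card A" using assms(1) by (intro indep_mod_le_card) auto
    then show ?thesis using assms(6) by simp
  qed
  then show ?thesis
    unfolding height_def prime_chain_def using C unfolding prime_chain_def
    by (intro antisym Sup_least Sup_upper) auto
qed

section \<open>The primes attached to a vertex set and a partition of its complement\<close>

definition vars :: "'v set \<Rightarrow> 'v edge_var set" where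
  "vars S = XVar ` S \<union> YVar ` S"

text \<open>The parameters are \<open>a\<^sub>i\<close> (index \<open>(0, i)\<close>) for the vertices and \<open>u\<^sub>c\<close>, \<open>w\<^sub>c\<close> (indices \<open>(1, c)\<close> and \<open>(2, c)\<close>) for the
  blocks of the partition given by \<open>f\<close>; the vertex \<open>i\<close> has the coordinates \<open>x\<^sub>i = a\<^sub>i u\<^sub>c\<close> and \<open>y\<^sub>i = a\<^sub>i w\<^sub>c\<close> with
  \<open>c = f i\<close>.\<close>

fun param_exponent :: "('v \<Rightarrow> 'v) \<Rightarrow> 'v edge_var \<Rightarrow> (nat \<times> 'v) \<Rightarrow>\<^sub>0 nat" where
  "param_exponent f (XVar i) = Poly_Mapping.single (0, i) 1 + Poly_Mapping.single (1, f i) 1"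
| "param_exponent f (YVar i) = Poly_Mapping.single (0, i) 1 + Poly_Mapping.single (2, f i) 1"

definition param :: "'v edge_var set \<Rightarrow> ('v \<Rightarrow> 'v) \<Rightarrow> 'v edge_var \<Rightarrow> (nat \<times> 'v, 'k :: comm_ring_1) mpoly" where
  "param Z f z = (if z \<in> Z then 0 else Poly_Mapping.single (param_exponent f z) 1)"

text \<open>The vanishing ideal of the configurations of vectors \<open>(x\<^sub>i, y\<^sub>i)\<close> in which the coordinates in \<open>Z\<close> vanish
  and the vectors in each fibre of \<open>f\<close> are parallel. Single coordinates may vanish, because a chain of
  maximal length has to kill \<open>x\<^sub>i\<close> and \<open>y\<^sub>i\<close> in two steps.\<close>

definition block_prime ::
    "'v set \<Rightarrow> 'v edge_var set \<Rightarrow> ('v \<Rightarrow> 'v) \<Rightarrow> ('v edge_var, 'k :: comm_ring_1) mpoly set" where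
  "block_prime V Z f = ker (vars V) (param Z f)"

definition edge_binomial :: "'v \<Rightarrow> 'v \<Rightarrow> ('v edge_var, 'k :: comm_ring_1) mpoly" where
  "edge_binomial i j = mvar (XVar i) * mvar (YVar j) - mvar (XVar j) * mvar (YVar i)"

lemma vars_simps [simp]:
  "XVar i \<in> vars S \<longleftrightarrow> i \<in> S" "YVar i \<in> vars S \<longleftrightarrow> i \<in> S" "vars {} = {}"
  by (auto simp: vars_def)

lemma vars_mono: "S \<subseteq> T \<Longrightarrow> vars S \<subseteq> vars T"
  by (auto simp: vars_def)

lemma vars_insert: "vars (insert i S) = insert (XVar i) (insert (YVar i) (vars S))"
  by (auto simp: vars_def)

lemma card_vars: "finite S \<Longrightarrow> card (vars S) = 2 * card S"
  unfolding vars_def by (subst card_Un_disjoint) (auto simp: card_image inj_on_def)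

lemma finite_vars: "finite S \<Longrightarrow> finite (vars S)"
  by (simp add: vars_def)

lemma param_simps:
  "XVar i \<notin> Z \<Longrightarrow> param Z f (XVar i) = mvar (0, i) * mvar (1, f i)"
  "YVar i \<notin> Z \<Longrightarrow> param Z f (YVar i) = mvar (0, i) * mvar (2, f i)"
  "z \<in> Z \<Longrightarrow> param Z f z = 0"
  by (simp_all add: param_def mvar_def mult_single)

lemma prime_block_prime:
  fixes V :: "'v :: linorder set"
  shows "primeideal (block_prime V Z f :: ('v edge_var, 'k :: field) mpoly set) (polynomial_ring (vars V))"
  unfolding block_prime_def by (rule prime_ker)

lemma edge_binomial_Pol: "i \<in> V \<Longrightarrow> j \<in> V \<Longrightarrow> edge_binomial i j \<in> Pol (vars V)"
  by (simp add: edge_binomial_def)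

lemma variable_in_block_prime:
  assumes "z \<in> vars V"
  shows "mvar z \<in> (block_prime V Z f :: ('v edge_var, 'k :: comm_ring_1) mpoly set) \<longleftrightarrow> z \<in> Z"
proof -
  have "Poly_Mapping.single e (1 :: 'k) \<noteq> 0" for e :: "(nat \<times> 'v) \<Rightarrow>\<^sub>0 nat"
    by (metis lookup_single_eq lookup_zero zero_neq_one)
  then show ?thesis using assms by (auto simp: block_prime_def ker_def param_def)
qed

lemma edge_binomial_in_block_prime:
  assumes "i \<in> V" "j \<in> V"
  shows "edge_binomial i j \<in> (block_prime V (vars S) f :: ('v edge_var, 'k :: comm_ring_1) mpoly set)
    \<longleftrightarrow> i \<in> S \<or> j \<in> S \<or> f i = f j"
proof -
  have "subst (param (vars S) f) (edge_binomial i j :: (_, 'k) mpoly) = 0 \<longleftrightarrow> i \<in> S \<or> j \<in> S \<or> f i = f j"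
  proof (cases "i \<in> S \<or> j \<in> S")
    case True
    then show ?thesis by (auto simp: edge_binomial_def param_simps)
  next
    case False
    let ?e = "\<lambda>i j. param_exponent f (XVar i) + param_exponent f (YVar j)"
    have "subst (param (vars S) f) (edge_binomial i j :: (_, 'k) mpoly)
        = Poly_Mapping.single (?e i j) 1 - Poly_Mapping.single (?e j i) 1"
      using False by (simp add: edge_binomial_def param_def mult_single)
    moreover have "Poly_Mapping.single e (1 :: 'k) - Poly_Mapping.single e' 1 = 0 \<longleftrightarrow> e = e'"
      for e e' :: "(nat \<times> 'v) \<Rightarrow>\<^sub>0 nat"
      by (metis lookup_single_eq lookup_single_not_eq right_minus_eq zero_neq_one)
    moreover have "?e i j = ?e j i \<longleftrightarrow> f i = f j"
    proof
      assume "?e i j = ?e j i"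
      then have "Poly_Mapping.lookup (?e i j) (1, f i) = Poly_Mapping.lookup (?e j i) (1, f i)" by simp
      then show "f i = f j"
        by (simp add: lookup_add lookup_single when_def split: if_splits)
    qed (simp add: ac_simps)
    ultimately show ?thesis using False by simp
  qed
  then show ?thesis using assms by (simp add: block_prime_def ker_def edge_binomial_Pol)
qed

text \<open>Setting \<open>a\<^sub>i\<close> to zero for the vertices of \<open>S'\<close> kills both of their coordinates, and identifying the
  parameters \<open>u\<^sub>c, w\<^sub>c\<close> of blocks merges these blocks. Only the partition of the vertices outside \<open>S'\<close> has to
  become coarser.\<close>

lemma block_prime_mono:
  assumes "S \<subseteq> S'"
    and f: "\<And>i j. i \<in> V - S' \<Longrightarrow> j \<in> V - S' \<Longrightarrow> f i = f j \<Longrightarrow> f' i = f' j"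
  shows "block_prime V (vars S) f \<subseteq> (block_prime V (vars S') f' :: ('v edge_var, 'k :: comm_ring_1) mpoly set)"
proof -
  \<comment> \<open>The new block into which the old block \<open>c\<close> is merged; arbitrary if \<open>c\<close> lies inside \<open>S'\<close>.\<close>
  define r where "r c = f' (SOME i. i \<in> V - S' \<and> f i = c)" for c
  have r: "r (f i) = f' i" if "i \<in> V - S'" for i
  proof -
    have "\<exists>j. j \<in> V - S' \<and> f j = f i" using that by blast
    then have "(SOME j. j \<in> V - S' \<and> f j = f i) \<in> V - S' \<and> f (SOME j. j \<in> V - S' \<and> f j = f i) = f i"
      by (rule someI_ex)
    then show ?thesis unfolding r_def using f that by blast
  qed
  define h :: "nat \<times> 'v \<Rightarrow> (nat \<times> 'v, 'k) mpoly" where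
    "h = (\<lambda>(n, c). if n = 0 then if c \<in> S' then 0 else mvar (0, c) else mvar (n, r c))"
  have "subst h (param (vars S) f z) = param (vars S') f' z" if "z \<in> vars V" for z
  proof (cases z)
    case (XVar i)
    then show ?thesis using that assms(1) r[of i]
      by (cases "i \<in> S"; cases "i \<in> S'") (auto simp: param_simps h_def)
  next
    case (YVar i)
    then show ?thesis using that assms(1) r[of i]
      by (cases "i \<in> S"; cases "i \<in> S'") (auto simp: param_simps h_def)
  qed
  then show ?thesis unfolding block_prime_def by (rule ker_mono)
qed

text \<open>With singleton blocks, \<open>u\<^sub>i\<close> and \<open>w\<^sub>i\<close> belong to the vertex \<open>i\<close> alone, so \<open>x\<^sub>i\<close> and \<open>y\<^sub>i\<close> can be killed separately by
  setting these parameters to zero.\<close>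

lemma block_prime_kill_mono:
  assumes "Z \<subseteq> Z'"
  shows "block_prime V Z id \<subseteq> (block_prime V Z' id :: ('v edge_var, 'k :: comm_ring_1) mpoly set)"
proof -
  define h :: "nat \<times> 'v \<Rightarrow> (nat \<times> 'v, 'k) mpoly" where
    "h = (\<lambda>(n, c). if n = 1 \<and> XVar c \<in> Z' \<or> n = 2 \<and> YVar c \<in> Z' then 0 else mvar (n, c))"
  have "subst h (param Z id z) = param Z' id z" for z
    using assms by (cases z; cases "z \<in> Z"; cases "z \<in> Z'") (auto simp: param_simps h_def)
  then show ?thesis unfolding block_prime_def by (intro ker_mono)
qed

definition has_chain :: "('a, 'm) ring_scheme \<Rightarrow> nat \<Rightarrow> 'a set \<Rightarrow> bool" where
  "has_chain R n P \<longleftrightarrow> (\<exists>C. prime_chain R n C \<and> C n = P)"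

lemma has_chain_0: "primeideal P R \<Longrightarrow> has_chain R 0 P"
  unfolding has_chain_def prime_chain_def by (intro exI[of _ "\<lambda>_. P"]) auto

lemma has_chain_Suc:
  assumes "has_chain R n P" "P \<subset> Q" "primeideal Q R"
  shows "has_chain R (Suc n) Q"
proof -
  obtain C where C: "prime_chain R n C" "C n = P" using assms(1) by (auto simp: has_chain_def)
  then have "prime_chain R (Suc n) (\<lambda>i. if i \<le> n then C i else Q)"
    using assms(2,3) by (auto simp: prime_chain_def less_Suc_eq)
  then show ?thesis unfolding has_chain_def by (intro exI[of _ "\<lambda>i. if i \<le> n then C i else Q"]) auto
qed

lemma chain_to_coordinate_prime:
  fixes V :: "'v :: linorder set"
  assumes "finite Z" "Z \<subseteq> vars V"
  shows "has_chain (polynomial_ring (vars V)) (card Z) (block_prime V Z id :: ('v edge_var, 'k :: field) mpoly set)"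
  using assms
proof (induction Z rule: finite_induct)
  case empty
  then show ?case using has_chain_0[OF prime_block_prime] by simp
next
  case (insert z Z)
  have "block_prime V Z id \<subset> (block_prime V (insert z Z) id :: ('v edge_var, 'k) mpoly set)"
    using insert block_prime_kill_mono[of Z "insert z Z" V] variable_in_block_prime[of z V Z]
      variable_in_block_prime[of z V "insert z Z"] by blast
  with insert have "has_chain (polynomial_ring (vars V)) (Suc (card Z)) (block_prime V (insert z Z) id :: ('v edge_var, 'k) mpoly set)"
    by (intro has_chain_Suc[OF _ _ prime_block_prime]) blast+
  then show ?case unfolding card_insert_disjoint[OF insert(1,2)] .
qed

text \<open>After the \<open>2 |S|\<close> variables of \<open>S\<close> have been killed, merging the singletons outside \<open>S\<close> into the blocks of \<open>f\<close> takes
  one step per lost block.\<close>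

lemma chain_to_block_prime:
  fixes V :: "'v :: linorder set"
  assumes V: "finite V" "S \<subseteq> V"
  shows "has_chain (polynomial_ring (vars V)) (2 * card S + (card (V - S) - card (f ` (V - S))))
    (block_prime V (vars S) f :: ('v edge_var, 'k :: field) mpoly set)"
proof (induction "card (V - S) - card (f ` (V - S))" arbitrary: f)
  case 0
  have fin: "finite (V - S)" using V by simp
  have "card (f ` (V - S)) = card (V - S)"
    using 0 card_image_le[OF fin, of f] by simp
  then have "inj_on f (V - S)" by (intro eq_card_imp_inj_on fin)
  then have "block_prime V (vars S) f = (block_prime V (vars S) id :: ('v edge_var, 'k) mpoly set)"
    by (intro antisym block_prime_mono) (auto simp: inj_on_def)
  moreover have "has_chain (polynomial_ring (vars V)) (card (vars S)) (block_prime V (vars S) id :: ('v edge_var, 'k) mpoly set)"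
    using V by (intro chain_to_coordinate_prime finite_vars vars_mono) (auto intro: finite_subset)
  ultimately show ?case using 0 V by (simp add: card_vars finite_subset)
next
  case (Suc k)
  have fin: "finite (V - S)" using V by simp
  have less: "card (f ` (V - S)) < card (V - S)" using Suc(2) by simp
  then have "\<not> inj_on f (V - S)" by (metis card_image less_irrefl)
  then obtain i j where ij: "i \<in> V - S" "j \<in> V - S" "i \<noteq> j" "f i = f j"
    by (auto simp: inj_on_def)
  \<comment> \<open>Some block has at least two vertices, so an unused label \<open>l\<close> is left for splitting off one of them.\<close>
  obtain l where l: "l \<in> V - S" "l \<notin> f ` (V - S)"
    using less fin by (metis card_mono finite_imageI leD subsetI)
  define f' where "f' = f(i := l)"
  have "f' ` (V - S) = insert l (f ` (V - S))"
  proof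
    show "insert l (f ` (V - S)) \<subseteq> f' ` (V - S)"
    proof
      fix c assume "c \<in> insert l (f ` (V - S))"
      then consider "c = f' i" | a where "a \<in> V - S" "a \<noteq> i" "c = f' a" | "c = f' j"
        using ij by (auto simp: f'_def)
      then show "c \<in> f' ` (V - S)" using ij by cases auto
    qed
  qed (auto simp: f'_def)
  then have card: "card (f' ` (V - S)) = Suc (card (f ` (V - S)))"
    using l fin by simp
  have "block_prime V (vars S) f' \<subseteq> (block_prime V (vars S) f :: ('v edge_var, 'k) mpoly set)"
    using l by (intro block_prime_mono) (auto simp: f'_def split: if_splits)
  moreover have "f' i \<noteq> f' j" using ij l by (auto simp: f'_def)
  then have "edge_binomial i j \<in> (block_prime V (vars S) f :: ('v edge_var, 'k) mpoly set) - block_prime V (vars S) f'"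
    using ij by (simp add: edge_binomial_in_block_prime)
  ultimately have "block_prime V (vars S) f' \<subset> (block_prime V (vars S) f :: ('v edge_var, 'k) mpoly set)"
    by blast
  moreover have "has_chain (polynomial_ring (vars V)) (2 * card S + k) (block_prime V (vars S) f' :: ('v edge_var, 'k) mpoly set)"
  proof -
    have k: "k = card (V - S) - card (f' ` (V - S))" using Suc(2) card by simp
    show ?thesis using Suc(1)[OF k] unfolding k[symmetric] .
  qed
  ultimately have "has_chain (polynomial_ring (vars V)) (Suc (2 * card S + k)) (block_prime V (vars S) f :: ('v edge_var, 'k) mpoly set)"
    by (intro has_chain_Suc[OF _ _ prime_block_prime])
  then show ?case by (simp add: Suc(2)[symmetric])
qed

text \<open>All \<open>y\<^sub>i\<close> with \<open>i \<notin> S\<close>, together with \<open>x\<^sub>i\<close> for one representative \<open>i\<close> of each block, are independent: their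
  images are monomials, and an exponent vector of these variables can be recovered from its image. The
  exponent of \<open>u\<^sub>c\<close> gives that of the variable \<open>x\<^sub>i\<close> of the representative of \<open>c\<close>, and then the exponent of \<open>a\<^sub>i\<close>
  gives that of \<open>y\<^sub>i\<close>.\<close>

lemma independent_variables_mod_block_prime:
  fixes V :: "'v :: linorder set"
  assumes V: "finite V" "S \<subseteq> V"
  shows "\<exists>t. (\<forall>i<card (V - S) + card (f ` (V - S)). t i \<in> Pol (vars V)) \<and>
    indep_mod (card (V - S) + card (f ` (V - S))) t (block_prime V (vars S) f :: ('v edge_var, 'k :: field) mpoly set)"
proof -
  let ?W = "V - S" and ?d = "card (V - S) + card (f ` (V - S))"
  define r where "r = inv_into ?W f"
  define B where "B = YVar ` ?W \<union> XVar ` r ` f ` ?W"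
  have r: "r c \<in> ?W" "f (r c) = c" if "c \<in> f ` ?W" for c
    using that unfolding r_def by (rule inv_into_into, rule f_inv_into_f)
  have "inj_on r (f ` ?W)" by (rule inj_on_inverseI[of _ f]) (use r in auto)
  then have "card (r ` f ` ?W) = card (f ` ?W)" by (rule card_image)
  then have "card B = ?d"
    unfolding B_def using V by (subst card_Un_disjoint) (auto simp: card_image inj_on_def)
  moreover have "finite B" using V by (simp add: B_def)
  ultimately obtain b where b: "bij_betw b {..<?d} B"
    using ex_bij_betw_nat_finite[of B] by (auto simp: atLeast0LessThan)
  have bB: "b i \<in> B" if "i < ?d" for i
    using b that by (auto simp: bij_betw_def)
  have b_inj: "b i = b j \<Longrightarrow> i = j" if "i < ?d" "j < ?d" for i j
    using b that by (auto simp: bij_betw_def inj_on_def)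
  have B_sub: "B \<subseteq> vars V - vars S"
    using r by (auto simp: B_def)
  let ?a = "\<lambda>i. param_exponent f (b i)"
  have inj: "inj_on (exponent_map ?a) {m. Poly_Mapping.keys m \<subseteq> {..<?d}}"
  proof (rule inj_onI)
    fix m n assume mn: "m \<in> {m. Poly_Mapping.keys m \<subseteq> {..<?d}}" "n \<in> {m. Poly_Mapping.keys m \<subseteq> {..<?d}}"
      and eq: "exponent_map ?a m = exponent_map ?a n"
    let ?m = "Poly_Mapping.lookup m" and ?n = "Poly_Mapping.lookup n"
      and ?w = "\<lambda>y i. Poly_Mapping.lookup (?a i) y"
    have "Poly_Mapping.lookup (exponent_map ?a k) y = (\<Sum>i<?d. Poly_Mapping.lookup k i * ?w y i)"
      if "Poly_Mapping.keys k \<subseteq> {..<?d}" for k y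
      unfolding lookup_exponent_map using that
      by (intro sum.mono_neutral_left) (auto simp: in_keys_iff)
    from this[of m] this[of n]
    have sums: "(\<Sum>i<?d. ?m i * ?w y i) = (\<Sum>i<?d. ?n i * ?w y i)" for y
      using mn eq by simp
    have peel: "?m k = ?n k" if "k < ?d" "?w y k = 1"
      and others: "\<And>i. i < ?d \<Longrightarrow> i \<noteq> k \<Longrightarrow> ?w y i \<noteq> 0 \<Longrightarrow> ?m i = ?n i" for k y
    proof -
      have "(\<Sum>i\<in>{..<?d} - {k}. ?m i * ?w y i) = (\<Sum>i\<in>{..<?d} - {k}. ?n i * ?w y i)"
      proof (intro sum.cong refl)
        fix i assume "i \<in> {..<?d} - {k}"
        then show "?m i * ?w y i = ?n i * ?w y i" using others[of i] by (cases "?w y i = 0") auto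
      qed
      then show ?thesis
        using sums[of y] that(1,2) by (simp add: sum.remove[of "{..<?d}" k])
    qed
    have X: "?m k = ?n k" if k: "k < ?d" "b k = XVar u" for k u
    proof (rule peel[of k "(1, f u)"])
      fix i assume i: "i < ?d" "i \<noteq> k" "?w (1, f u) i \<noteq> 0"
      then obtain u' where u': "b i = XVar u'" "f u' = f u"
        by (cases "b i") (auto simp: lookup_add lookup_single when_def split: if_splits)
      then have "u' = u" using bB[OF i(1)] bB[OF k(1)] k(2) r by (auto simp: B_def)
      then show "?m i = ?n i" using b_inj[OF i(1) k(1)] u' k(2) i(2) by simp
    qed (use k in \<open>auto simp: lookup_add lookup_single when_def\<close>)
    have Y: "?m k = ?n k" if k: "k < ?d" "b k = YVar u" for k u
    proof (rule peel[of k "(0, u)"])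
      fix i assume i: "i < ?d" "i \<noteq> k" "?w (0, u) i \<noteq> 0"
      then have "b i = XVar u \<or> b i = YVar u"
        by (cases "b i") (auto simp: lookup_add lookup_single when_def split: if_splits)
      then show "?m i = ?n i" using X[OF i(1)] b_inj[OF i(1) k(1)] i(2) k(2) by auto
    qed (use k in \<open>auto simp: lookup_add lookup_single when_def\<close>)
    show "m = n"
    proof (rule poly_mapping_eqI)
      fix k
      show "?m k = ?n k"
      proof (cases "k < ?d")
        case True
        then show ?thesis using X Y by (cases "b k") auto
      next
        case False
        then have "k \<notin> Poly_Mapping.keys m" "k \<notin> Poly_Mapping.keys n" using mn by auto
        then show ?thesis by (simp add: in_keys_iff)
      qed
    qed
  qed
  have "indep_mod ?d (\<lambda>i. mvar (b i)) (block_prime V (vars S) f :: ('v edge_var, 'k) mpoly set)"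
    unfolding indep_mod_def
  proof safe
    fix q :: "(nat, 'k) mpoly"
    assume q: "q \<in> Pol {..<?d}" and "subst (\<lambda>i. mvar (b i)) q \<in> block_prime V (vars S) f"
    then have "subst (\<lambda>i. param (vars S) f (b i)) q = 0"
      by (simp add: block_prime_def ker_def subst_subst)
    also have "subst (\<lambda>i. param (vars S) f (b i)) q = subst (\<lambda>i. Poly_Mapping.single (?a i) 1) q"
      using bB B_sub by (intro subst_cong[OF q]) (auto simp: param_def)
    finally show "q = 0" using q inj by (intro monomial_map_injective[where a = ?a and B = "{..<?d}"])
  qed
  moreover have "mvar (b i) \<in> Pol (vars V)" if "i < ?d" for i
    using bB[OF that] B_sub by auto
  ultimately show ?thesis by (intro exI[of _ "\<lambda>i. mvar (b i)"]) auto
qed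

theorem height_block_prime:
  fixes V :: "'v :: linorder set"
  assumes V: "finite V" "S \<subseteq> V"
  shows "height (polynomial_ring (vars V)) (block_prime V (vars S) f :: ('v edge_var, 'k :: field) mpoly set)
    = enat (2 * card S + (card (V - S) - card (f ` (V - S))))"
proof -
  obtain C where C: "prime_chain (polynomial_ring (vars V)) (2 * card S + (card (V - S) - card (f ` (V - S)))) C"
    "C (2 * card S + (card (V - S) - card (f ` (V - S)))) = (block_prime V (vars S) f :: ('v edge_var, 'k) mpoly set)"
    using chain_to_block_prime[OF V] unfolding has_chain_def by blast
  obtain t where t: "\<forall>i<card (V - S) + card (f ` (V - S)). t i \<in> Pol (vars V)"
    "indep_mod (card (V - S) + card (f ` (V - S))) t (block_prime V (vars S) f :: ('v edge_var, 'k) mpoly set)"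
    using independent_variables_mod_block_prime[OF V] by blast
  have "card (f ` (V - S)) \<le> card (V - S)" using V by (intro card_image_le) auto
  moreover have "card V = card S + card (V - S)"
    using V by (metis card_Diff_subset card_mono finite_subset le_add_diff_inverse)
  ultimately have "card (vars V) \<le> card (V - S) + card (f ` (V - S)) + (2 * card S + (card (V - S) - card (f ` (V - S))))"
    using V(1) by (simp add: card_vars)
  then show ?thesis
    using t finite_vars[OF V(1)]
    by (intro height_eqI[OF _ C, where d = "card (V - S) + card (f ` (V - S))" and t = t]) blast+
qed

section \<open>Binomial edge ideals are intersections of block primes\<close>

text \<open>An explicit form of the generated ideal, which provides induction on membership.\<close>

inductive_set generated :: "'x set \<Rightarrow> ('x, 'k :: comm_ring_1) mpoly set \<Rightarrow> ('x, 'k) mpoly set"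
  for A F where
  zero: "0 \<in> generated A F"
| step: "p \<in> generated A F \<Longrightarrow> f \<in> F \<Longrightarrow> q \<in> Pol A \<Longrightarrow> q * f + p \<in> generated A F"

lemma generated_add: "p \<in> generated A F \<Longrightarrow> q \<in> generated A F \<Longrightarrow> p + q \<in> generated A F"
  by (induction p rule: generated.induct) (auto simp: add.assoc intro: generated.step)

lemma generated_mult: "p \<in> generated A F \<Longrightarrow> q \<in> Pol A \<Longrightarrow> q * p \<in> generated A F"
  by (induction p rule: generated.induct)
    (auto simp: distrib_left intro: generated.zero generated.step simp flip: mult.assoc)

lemma generated_base: "f \<in> F \<Longrightarrow> f \<in> generated A F"
  using generated.step[OF generated.zero, of f F 1 A] by simp

lemma generated_Pol: "F \<subseteq> Pol A \<Longrightarrow> p \<in> generated A F \<Longrightarrow> p \<in> Pol A"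
  by (erule generated.induct) auto

lemma generated_uminus: "p \<in> generated A F \<Longrightarrow> - p \<in> generated A F"
  using generated_mult[of p A F "- 1"] by auto

lemma generated_subset:
  assumes "\<And>f. f \<in> F \<Longrightarrow> f \<in> generated A F'" "p \<in> generated A F"
  shows "p \<in> generated A F'"
  using assms(2) by induction (auto intro: generated.zero generated_add generated_mult assms(1))

lemma genideal_polynomial_ring:
  fixes F :: "('x, 'k :: comm_ring_1) mpoly set"
  assumes "F \<subseteq> Pol A"
  shows "Idl\<^bsub>polynomial_ring A\<^esub> F = generated A F"
proof -
  interpret cring "polynomial_ring A :: ('x, 'k) mpoly ring" by (rule cring_polynomial_ring)
  have "ideal (generated A F) (polynomial_ring A)"
    using assms by (intro ideal_polynomial_ringI) (auto intro: generated_Pol generated.zero generated_add generated_mult)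
  then have "Idl\<^bsub>polynomial_ring A\<^esub> F \<subseteq> generated A F"
    by (rule genideal_minimal) (auto intro: generated_base)
  moreover have "p \<in> Idl\<^bsub>polynomial_ring A\<^esub> F" if "p \<in> generated A F" for p
  proof -
    have F: "F \<subseteq> carrier (polynomial_ring A)" using assms by (simp only: carrier_polynomial_ring)
    note I = ideal_polynomial_ringD[OF genideal_ideal[OF F]]
    show ?thesis using that
      by induction (use I genideal_self[OF F] in auto)
  qed
  ultimately show ?thesis by blast
qed

text \<open>The vertices of \<open>S\<close> have been deleted from the graph, but their variables are kept as generators, so that
  the whole induction on the graph takes place in one ring.\<close>

definition partial_edge_ideal ::
    "'v set \<Rightarrow> 'v set \<Rightarrow> ('v \<times> 'v) set \<Rightarrow> ('v edge_var, 'k :: comm_ring_1) mpoly set" where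
  "partial_edge_ideal V S E =
     generated (vars V) (mvar ` vars S \<union> {edge_binomial i j | i j. (i, j) \<in> E})"

lemma partial_edge_ideal_variable: "z \<in> vars S \<Longrightarrow> mvar z \<in> partial_edge_ideal V S E"
  unfolding partial_edge_ideal_def by (intro generated_base) auto

lemma partial_edge_ideal_edge: "(i, j) \<in> E \<Longrightarrow> edge_binomial i j \<in> partial_edge_ideal V S E"
  unfolding partial_edge_ideal_def by (intro generated_base) auto

lemma partial_edge_ideal_add:
  "p \<in> partial_edge_ideal V S E \<Longrightarrow> q \<in> partial_edge_ideal V S E \<Longrightarrow> p + q \<in> partial_edge_ideal V S E"
  unfolding partial_edge_ideal_def by (rule generated_add)

lemma partial_edge_ideal_mult:
  "p \<in> partial_edge_ideal V S E \<Longrightarrow> q \<in> Pol (vars V) \<Longrightarrow> q * p \<in> partial_edge_ideal V S E"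
  unfolding partial_edge_ideal_def by (rule generated_mult)

lemma partial_edge_ideal_0: "0 \<in> partial_edge_ideal V S E"
  unfolding partial_edge_ideal_def by (rule generated.zero)

lemma partial_edge_ideal_induct [consumes 1, case_names zero add variable edge]:
  assumes "p \<in> partial_edge_ideal V S E"
    and "P 0" "\<And>p q. P p \<Longrightarrow> P q \<Longrightarrow> P (p + q)"
    and "\<And>z q. z \<in> vars S \<Longrightarrow> q \<in> Pol (vars V) \<Longrightarrow> P (q * mvar z)"
    and "\<And>i j q. (i, j) \<in> E \<Longrightarrow> q \<in> Pol (vars V) \<Longrightarrow> P (q * edge_binomial i j)"
  shows "P p"
  using assms(1) unfolding partial_edge_ideal_def
  by (induction rule: generated.induct) (auto intro: assms)

section \<open>Disjoint unions of cliques\<close>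

lemma finite_positive_excess:
  fixes g h :: "'a \<Rightarrow> nat"
  assumes "finite B" "(\<Sum>x\<in>B. g x) = (\<Sum>x\<in>B. h x)" "i \<in> B" "h i < g i"
  shows "\<exists>j\<in>B. g j < h j"
proof (rule ccontr)
  assume "\<not> ?thesis"
  then have "(\<Sum>x\<in>B. h x) < (\<Sum>x\<in>B. g x)"
    using assms by (intro sum_strict_mono_ex1) (auto simp: not_less)
  then show False using assms by simp
qed

text \<open>The image of a monomial records the degree in each vertex and the degree in the \<open>x\<close>-variables of each block.\<close>

lemma lookup_param_exponent:
  assumes "finite V" "Poly_Mapping.keys m \<subseteq> vars V"
  shows "Poly_Mapping.lookup (exponent_map (param_exponent f) m) (0, i) =
      Poly_Mapping.lookup m (XVar i) + Poly_Mapping.lookup m (YVar i)"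
    and "Poly_Mapping.lookup (exponent_map (param_exponent f) m) (1, c) =
      (\<Sum>i\<in>{i\<in>V. f i = c}. Poly_Mapping.lookup m (XVar i))"
proof -
  have sum_vars: "(\<Sum>z\<in>vars V. h z) = (\<Sum>i\<in>V. h (XVar i) + h (YVar i))" for h :: "'a edge_var \<Rightarrow> nat"
    unfolding vars_def using assms(1)
    by (subst sum.union_disjoint) (auto simp: sum.reindex inj_on_def sum.distrib)
  have "Poly_Mapping.lookup (exponent_map (param_exponent f) m) y =
      (\<Sum>z\<in>vars V. Poly_Mapping.lookup m z * Poly_Mapping.lookup (param_exponent f z) y)" for y
    unfolding lookup_exponent_map using assms finite_vars[OF assms(1)]
    by (intro sum.mono_neutral_left) (auto simp: in_keys_iff)
  note * = this[unfolded sum_vars]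
  show "Poly_Mapping.lookup (exponent_map (param_exponent f) m) (0, i) =
      Poly_Mapping.lookup m (XVar i) + Poly_Mapping.lookup m (YVar i)"
  proof (cases "i \<in> V")
    case True
    then show ?thesis using assms(1)
      by (simp add: * lookup_add lookup_single when_def if_distrib[of "\<lambda>x. _ * x"] sum.distrib cong: if_cong)
  next
    case False
    then have "Poly_Mapping.lookup m (XVar i) = 0" "Poly_Mapping.lookup m (YVar i) = 0"
      using assms(2) by (auto simp: in_keys_iff vars_def)
    then show ?thesis using False by (auto simp: * lookup_add lookup_single when_def intro!: sum.neutral)
  qed
  show "Poly_Mapping.lookup (exponent_map (param_exponent f) m) (1, c) =
      (\<Sum>i\<in>{i\<in>V. f i = c}. Poly_Mapping.lookup m (XVar i))"
    using assms(1)
    by (simp add: * lookup_add lookup_single when_def if_distrib[of "\<lambda>x. _ * x"] sum.inter_filter cong: if_cong)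
qed

text \<open>Let two monomials have the same image. If \<open>x\<^sub>i\<close> occurs more often in \<open>m\<close> than in \<open>n\<close>, then some \<open>x\<^sub>j\<close> of the same
  block occurs less often, because the \<open>x\<close>-degrees of the block agree; as the degrees in the vertex \<open>j\<close> agree, \<open>m\<close>
  contains \<open>y\<^sub>j\<close>. Replacing \<open>x\<^sub>i y\<^sub>j\<close> by \<open>x\<^sub>j y\<^sub>i\<close> changes \<open>m\<close> by a multiple of an edge binomial and brings it closer to
  \<open>n\<close>.\<close>

lemma straightening:
  fixes c :: "'k :: comm_ring_1"
  assumes V: "finite V" and m: "Poly_Mapping.keys m \<subseteq> vars V - vars S"
    and n: "Poly_Mapping.keys n \<subseteq> vars V - vars S"
    and E: "\<And>i j. i \<in> V - S \<Longrightarrow> j \<in> V - S \<Longrightarrow> i \<noteq> j \<Longrightarrow> f i = f j \<Longrightarrow> (i, j) \<in> E"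
    and eq: "exponent_map (param_exponent f) m = exponent_map (param_exponent f) n"
  shows "Poly_Mapping.single m c - Poly_Mapping.single n c \<in> partial_edge_ideal V S E"
  using m eq
proof (induction "\<Sum>i\<in>V. Poly_Mapping.lookup m (XVar i) - Poly_Mapping.lookup n (XVar i)"
    arbitrary: m rule: less_induct)
  case less
  let ?x = "\<lambda>m i. Poly_Mapping.lookup m (XVar i)" and ?y = "\<lambda>m i. Poly_Mapping.lookup m (YVar i)"
  have mV: "Poly_Mapping.keys m \<subseteq> vars V" and nV: "Poly_Mapping.keys n \<subseteq> vars V"
    using less.prems n by auto
  have deg: "?x m i + ?y m i = ?x n i + ?y n i" for i
    using lookup_param_exponent(1)[OF V mV, of f i] lookup_param_exponent(1)[OF V nV, of f i] less.prems by simp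
  have block: "(\<Sum>i\<in>{i\<in>V. f i = c}. ?x m i) = (\<Sum>i\<in>{i\<in>V. f i = c}. ?x n i)" for c
    using lookup_param_exponent(2)[OF V mV, of f c] lookup_param_exponent(2)[OF V nV, of f c] less.prems by simp
  show ?case
  proof (cases "\<exists>i\<in>V. ?x n i < ?x m i")
    case False
    have "?x m i = ?x n i" for i
    proof (cases "i \<in> V")
      case True
      show ?thesis
      proof (rule ccontr)
        assume "?x m i \<noteq> ?x n i"
        then have "?x m i < ?x n i" using False True by (meson linorder_neqE_nat)
        then have "\<exists>j\<in>{j \<in> V. f j = f i}. ?x n j < ?x m j"
          using V True block[of "f i"] by (intro finite_positive_excess[where i = i]) auto
        then show False using False by blast
      qed
    next
      case False
      then have "XVar i \<notin> Poly_Mapping.keys m" "XVar i \<notin> Poly_Mapping.keys n" using mV nV by auto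
      then show ?thesis by (simp add: in_keys_iff)
    qed
    moreover from this have "?y m i = ?y n i" for i using deg[of i] by simp
    ultimately have "m = n" by (intro poly_mapping_eqI) (metis edge_var.exhaust)
    then show ?thesis by (simp add: partial_edge_ideal_0)
  next
    case True
    then obtain i where i: "i \<in> V" "?x n i < ?x m i" by blast
    then obtain j where j: "j \<in> V" "f j = f i" "?x m j < ?x n j"
      using finite_positive_excess[of "{j \<in> V. f j = f i}" "?x m" "?x n" i] block V by auto
    have "XVar i \<in> Poly_Mapping.keys m" "XVar j \<in> Poly_Mapping.keys n"
      using i j by (auto simp: in_keys_iff)
    then have ij: "i \<in> V - S" "j \<in> V - S" "i \<noteq> j" using less.prems(1) n i j by auto
    have y: "0 < ?y m j" using deg[of j] j by simp
    define k where "k = m - Poly_Mapping.single (XVar i) 1 - Poly_Mapping.single (YVar j) 1"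
    have m_eq: "m = k + Poly_Mapping.single (XVar i) 1 + Poly_Mapping.single (YVar j) 1"
      using i y by (intro poly_mapping_eqI) (auto simp: k_def lookup_add lookup_minus lookup_single when_def)
    define m' where "m' = k + Poly_Mapping.single (XVar j) 1 + Poly_Mapping.single (YVar i) 1"
    have "Poly_Mapping.single m c - Poly_Mapping.single m' c = Poly_Mapping.single k c * edge_binomial i j"
      by (simp add: edge_binomial_def m_eq m'_def mvar_def right_diff_distrib mult_single add.assoc)
    moreover have k_vars: "Poly_Mapping.keys k \<subseteq> vars V - vars S"
      using less.prems(1) by (simp add: m_eq keys_plus_nat)
    ultimately have 1: "Poly_Mapping.single m c - Poly_Mapping.single m' c \<in> partial_edge_ideal V S E"
      using ij j(2) by (auto intro!: partial_edge_ideal_mult partial_edge_ideal_edge E Pol_single)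
    have x': "?x m' l = (if l = i then ?x m i - 1 else if l = j then ?x m j + 1 else ?x m l)" for l
      using ij by (auto simp: m_eq m'_def lookup_add lookup_single when_def)
    have m': "Poly_Mapping.keys m' \<subseteq> vars V - vars S"
      using k_vars ij by (auto simp: m'_def keys_plus_nat)
    have "exponent_map (param_exponent f) m' = exponent_map (param_exponent f) m"
      using j(2) by (simp add: m_eq m'_def exponent_map_add exponent_map_variable ac_simps)
    moreover have "(\<Sum>l\<in>V. ?x m' l - ?x n l) < (\<Sum>l\<in>V. ?x m l - ?x n l)"
    proof (rule sum_strict_mono_ex1)
      show "\<forall>l\<in>V. ?x m' l - ?x n l \<le> ?x m l - ?x n l" using j(3) by (auto simp: x')
      show "\<exists>l\<in>V. ?x m' l - ?x n l < ?x m l - ?x n l" using i by (auto simp: x' intro!: bexI[of _ i])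
    qed (use V in auto)
    ultimately have "Poly_Mapping.single m' c - Poly_Mapping.single n c \<in> partial_edge_ideal V S E"
      using m' less.prems(2) by (intro less.hyps) auto
    from partial_edge_ideal_add[OF 1 this] show ?thesis by simp
  qed
qed

text \<open>If the blocks are cliques, the killed monomials and the differences of monomials in one fibre all lie in
  the edge ideal, and these span the kernel.\<close>

lemma block_prime_subset_cliques:
  fixes p :: "('v edge_var, 'k :: comm_ring_1) mpoly"
  assumes V: "finite V" and p: "p \<in> block_prime V (vars S) f"
    and E: "\<And>i j. i \<in> V - S \<Longrightarrow> j \<in> V - S \<Longrightarrow> i \<noteq> j \<Longrightarrow> f i = f j \<Longrightarrow> (i, j) \<in> E"
  shows "p \<in> partial_edge_ideal V S E"
proof (rule monomial_kernel_induct[where Z = "vars S" and a = "param_exponent f" and K = "{m. Poly_Mapping.keys m \<subseteq> vars V}"])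
  show "subst (\<lambda>x. if x \<in> vars S then 0 else Poly_Mapping.single (param_exponent f x) 1) p = 0"
    using p by (simp add: block_prime_def ker_def param_def[abs_def])
  show "Poly_Mapping.keys p \<subseteq> {m. Poly_Mapping.keys m \<subseteq> vars V}"
    using p by (auto simp: block_prime_def ker_def Pol_def)
next
  fix m :: "'v edge_var \<Rightarrow>\<^sub>0 nat" and c assume m: "m \<in> {m. Poly_Mapping.keys m \<subseteq> vars V}" "Poly_Mapping.keys m \<inter> vars S \<noteq> {}"
  then obtain z where z: "z \<in> Poly_Mapping.keys m" "z \<in> vars S" by blast
  define k where "k = m - Poly_Mapping.single z 1"
  have m_eq: "m = k + Poly_Mapping.single z 1"
    using z by (intro poly_mapping_eqI) (auto simp: k_def lookup_add lookup_minus lookup_single when_def in_keys_iff)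
  have "Poly_Mapping.single m c = Poly_Mapping.single k c * mvar z"
    by (simp add: m_eq mvar_def mult_single)
  moreover have "Poly_Mapping.single k c \<in> Pol (vars V)"
    using m by (intro Pol_single) (simp add: m_eq keys_plus_nat)
  ultimately show "Poly_Mapping.single m c \<in> partial_edge_ideal V S E"
    using z by (simp add: partial_edge_ideal_mult partial_edge_ideal_variable)
next
  fix m n :: "'v edge_var \<Rightarrow>\<^sub>0 nat" and c
  assume "m \<in> {m. Poly_Mapping.keys m \<subseteq> vars V}" "n \<in> {m. Poly_Mapping.keys m \<subseteq> vars V}"
    "Poly_Mapping.keys m \<inter> vars S = {}" "Poly_Mapping.keys n \<inter> vars S = {}"
    "exponent_map (param_exponent f) m = exponent_map (param_exponent f) n"
  then show "Poly_Mapping.single m c - Poly_Mapping.single n c \<in> partial_edge_ideal V S E"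
    by (intro straightening[OF V _ _ E]) auto
qed (auto intro: partial_edge_ideal_0 partial_edge_ideal_add)

section \<open>Completing the neighbourhood of a vertex\<close>

definition complete_at :: "'v \<Rightarrow> ('v \<times> 'v) set \<Rightarrow> ('v \<times> 'v) set" where
  "complete_at v E = E \<union> {(j, k). (j, v) \<in> E \<and> (v, k) \<in> E \<and> j \<noteq> k}"

text \<open>The retraction onto the polynomials that do not involve the vertex \<open>v\<close>.\<close>

definition kill_vertex :: "'v \<Rightarrow> ('v edge_var, 'k) mpoly \<Rightarrow> ('v edge_var, 'k :: comm_ring_1) mpoly" where
  "kill_vertex v = subst (\<lambda>z. if z = XVar v \<or> z = YVar v then 0 else mvar z)"

lemma kill_vertex_simps:
  "kill_vertex v 0 = 0" "kill_vertex v (p + q) = kill_vertex v p + kill_vertex v q"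
  "kill_vertex v (p * q) = kill_vertex v p * kill_vertex v q"
  "kill_vertex v (mvar (XVar i)) = (if i = v then 0 else mvar (XVar i))"
  "kill_vertex v (mvar (YVar i)) = (if i = v then 0 else mvar (YVar i))"
  by (simp_all add: kill_vertex_def)

lemma kill_vertex_edge_binomial:
  "kill_vertex v (edge_binomial i j) = (if i = v \<or> j = v then 0 else edge_binomial i j)"
  by (simp add: kill_vertex_def edge_binomial_def)

lemma kill_vertex_Pol: "p \<in> Pol (vars V) \<Longrightarrow> kill_vertex v p \<in> Pol (vars V)"
  unfolding kill_vertex_def by (erule Pol_subst) auto

lemma diff_kill_vertex:
  assumes "p \<in> Pol (vars V)"
  obtains q r where "q \<in> Pol (vars V)" "r \<in> Pol (vars V)"
    "p - kill_vertex v p = q * mvar (XVar v) + r * mvar (YVar v)"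
proof -
  have split: "\<exists>q\<in>Pol (vars V). p = subst (mvar(z := 0)) p + q * mvar z" if p: "p \<in> Pol (vars V)" for p :: "('a edge_var, 'b) mpoly" and z
  proof -
    obtain q where q: "p = subst (mvar(z := 0)) p + mvar z * q"
      "\<And>m. m \<in> Poly_Mapping.keys q \<Longrightarrow> m + Poly_Mapping.single z 1 \<in> Poly_Mapping.keys p"
      using split_variable[of p z] by blast
    have "q \<in> Pol (vars V)"
      unfolding Pol_def
    proof safe
      fix m x assume "m \<in> Poly_Mapping.keys q" "x \<in> Poly_Mapping.keys m"
      then have "m + Poly_Mapping.single z 1 \<in> Poly_Mapping.keys p" "x \<in> Poly_Mapping.keys (m + Poly_Mapping.single z 1)"
        using q(2) by (auto simp: keys_plus_nat)
      then show "x \<in> vars V" using p by (auto simp: Pol_def)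
    qed
    then show ?thesis using q(1) by (intro bexI[of _ q]) (simp_all add: mult.commute)
  qed
  let ?p' = "subst (mvar(XVar v := 0)) p"
  obtain q where q: "q \<in> Pol (vars V)" "p = ?p' + q * mvar (XVar v)" using split[OF assms] by blast
  have "?p' \<in> Pol (vars V)" using assms by (rule Pol_subst) auto
  then obtain r where r: "r \<in> Pol (vars V)" "?p' = subst (mvar(YVar v := 0)) ?p' + r * mvar (YVar v)"
    using split by blast
  have "subst (mvar(YVar v := 0)) ?p' = kill_vertex v p"
    unfolding kill_vertex_def subst_subst by (intro arg_cong[of _ _ "\<lambda>g. subst g p"]) auto
  then have r': "?p' = kill_vertex v p + r * mvar (YVar v)" using r(2) by (rule back_subst[of "\<lambda>x. ?p' = x + _", rotated])
  have "a - k = c + d" if "a = b + c" "b = k + d" for a b c d k :: "('a edge_var, 'b) mpoly"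
    using that by simp
  from this[OF q(2) r'] have "p - kill_vertex v p = q * mvar (XVar v) + r * mvar (YVar v)" .
  then show thesis using that q r by blast
qed

text \<open>The Pluecker-type relations between three columns of a matrix with two rows.\<close>

lemma variable_times_completed_edge:
  assumes "(j, v) \<in> E" "(v, k) \<in> E" "{j, k, v} \<subseteq> V"
  shows "mvar (XVar v) * edge_binomial j k \<in> partial_edge_ideal V S E"
    and "mvar (YVar v) * edge_binomial j k \<in> partial_edge_ideal V S E"
proof -
  have 1: "mvar (XVar v) * edge_binomial j k
    = mvar (XVar j) * edge_binomial v k + mvar (XVar k) * edge_binomial j v"
    and 2: "mvar (YVar v) * edge_binomial j k
    = mvar (YVar j) * edge_binomial v k + mvar (YVar k) * edge_binomial j v"
    by (simp_all add: edge_binomial_def algebra_simps)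
  show "mvar (XVar v) * edge_binomial j k \<in> partial_edge_ideal V S E"
    "mvar (YVar v) * edge_binomial j k \<in> partial_edge_ideal V S E"
    unfolding 1 2 using assms
    by (auto intro!: partial_edge_ideal_add partial_edge_ideal_mult partial_edge_ideal_edge)
qed

text \<open>The part of \<open>p\<close> that involves \<open>v\<close>. A multiple \<open>q f\<^sub>j\<^sub>k\<close> of a new edge binomial contributes
  \<open>(q - q|\<^bsub>v=0\<^esub>) f\<^sub>j\<^sub>k\<close>, whose first factor is in the ideal of \<open>x\<^sub>v\<close> and \<open>y\<^sub>v\<close>; these variables
  multiply the new edges into the ideal of the old ones.\<close>

lemma completed_diff_kill_vertex:
  assumes E: "E \<subseteq> (V - S) \<times> (V - S)" and "v \<in> V - S" and S: "S \<subseteq> V"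
    and p: "p \<in> partial_edge_ideal V S (complete_at v E)"
  shows "p - kill_vertex v p \<in> partial_edge_ideal V S E"
  using p
proof (induction rule: partial_edge_ideal_induct)
  case zero
  then show ?case by (simp add: kill_vertex_simps partial_edge_ideal_0)
next
  case (add p q)
  then have "(p - kill_vertex v p) + (q - kill_vertex v q) \<in> partial_edge_ideal V S E"
    by (rule partial_edge_ideal_add)
  then show ?case by (simp add: kill_vertex_simps algebra_simps)
next
  case (variable z q)
  have "z \<noteq> XVar v" "z \<noteq> YVar v" using variable assms(2) by auto
  then have "q * mvar z - kill_vertex v (q * mvar z) = (q - kill_vertex v q) * mvar z"
    by (cases z) (simp_all add: kill_vertex_simps algebra_simps)
  then show ?case using variable
    by (auto intro!: partial_edge_ideal_mult partial_edge_ideal_variable kill_vertex_Pol)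
next
  case (edge j k q)
  consider "j = v \<or> k = v" "(j, k) \<in> E" | "j \<noteq> v" "k \<noteq> v" "(j, k) \<in> E"
    | "j \<noteq> v" "k \<noteq> v" "(j, v) \<in> E" "(v, k) \<in> E"
    using edge by (auto simp: complete_at_def)
  then show ?case
  proof cases
    case 1
    then show ?thesis using edge
      by (auto simp: kill_vertex_simps kill_vertex_edge_binomial intro!: partial_edge_ideal_mult partial_edge_ideal_edge)
  next
    case 2
    then have "q * edge_binomial j k - kill_vertex v (q * edge_binomial j k) = (q - kill_vertex v q) * edge_binomial j k"
      by (simp add: kill_vertex_simps kill_vertex_edge_binomial algebra_simps)
    then show ?thesis using edge 2
      by (auto intro!: partial_edge_ideal_mult partial_edge_ideal_edge kill_vertex_Pol)
  next
    case 3
    obtain a b where ab: "a \<in> Pol (vars V)" "b \<in> Pol (vars V)"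
      "q - kill_vertex v q = a * mvar (XVar v) + b * mvar (YVar v)"
      using diff_kill_vertex[OF edge(2)] .
    have "q * edge_binomial j k - kill_vertex v (q * edge_binomial j k) = (q - kill_vertex v q) * edge_binomial j k"
      using 3 by (simp add: kill_vertex_simps kill_vertex_edge_binomial algebra_simps)
    also have "\<dots> = a * (mvar (XVar v) * edge_binomial j k) + b * (mvar (YVar v) * edge_binomial j k)"
      by (simp add: ab algebra_simps)
    also have "\<dots> \<in> partial_edge_ideal V S E"
      using 3 ab E by (intro partial_edge_ideal_add partial_edge_ideal_mult variable_times_completed_edge) auto
    finally show ?thesis .
  qed
qed

text \<open>The part of \<open>p\<close> that does not involve \<open>v\<close>: the retraction kills \<open>x\<^sub>v\<close> and \<open>y\<^sub>v\<close> and fixes all other generators.\<close>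

lemma deleted_kill_vertex:
  assumes p: "p \<in> partial_edge_ideal V (insert v S) (E \<inter> (- {v}) \<times> (- {v}))"
  shows "kill_vertex v p \<in> partial_edge_ideal V S E"
  using p
proof (induction rule: partial_edge_ideal_induct)
  case (variable z q)
  then show ?case
    by (cases z) (auto simp: kill_vertex_simps vars_insert partial_edge_ideal_0
      intro!: partial_edge_ideal_mult partial_edge_ideal_variable kill_vertex_Pol)
next
  case (edge i j q)
  then show ?case
    by (auto simp: kill_vertex_simps kill_vertex_edge_binomial
      intro!: partial_edge_ideal_mult partial_edge_ideal_edge kill_vertex_Pol)
qed (simp_all add: kill_vertex_simps partial_edge_ideal_0 partial_edge_ideal_add)

text \<open>The family of all primes that obviously contain the ideal is used here instead of the component primes
  alone, because it restricts well to both simpler configurations: a partition that is compatible with more edges, or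
  with more deleted vertices, is compatible with the original data. The measure counts the pairs,
  including the diagonal, that are not edges; completing a neighbourhood removes such a pair, and deleting
  \<open>v\<close> removes at least \<open>(v, v)\<close>.\<close>

lemma partial_edge_ideal_decomposition:
  fixes p :: "('v edge_var, 'k :: comm_ring_1) mpoly"
  assumes "finite V" "S \<subseteq> V" "E \<subseteq> (V - S) \<times> (V - S)" "sym E" "irrefl E"
    and "\<And>T f. S \<subseteq> T \<Longrightarrow> T \<subseteq> V \<Longrightarrow> (\<And>i j. (i, j) \<in> E \<Longrightarrow> i \<notin> T \<Longrightarrow> j \<notin> T \<Longrightarrow> f i = f j) \<Longrightarrow>
      p \<in> block_prime V (vars T) f"
  shows "p \<in> partial_edge_ideal V S E"
  using assms
proof (induction "card ((V - S) \<times> (V - S) - E)" arbitrary: S E rule: less_induct)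
  case less
  have fin: "finite ((V - S) \<times> (V - S))" using less.prems(1) by simp
  show ?case
  proof (cases "\<forall>v i k. (i, v) \<in> E \<longrightarrow> (v, k) \<in> E \<longrightarrow> i \<noteq> k \<longrightarrow> (i, k) \<in> E")
    case True
    \<comment> \<open>Disjoint cliques: the closed neighbourhoods are the components, and \<open>f\<close> picks a vertex of each.\<close>
    define nbhd where "nbhd i = insert i (E `` {i})" for i
    have nbhd: "nbhd i = nbhd j" if "(i, j) \<in> E" for i j
      unfolding nbhd_def using that True \<open>sym E\<close> by (auto dest: symD)
    define f where "f i = (SOME j. j \<in> nbhd i)" for i
    have f: "f i \<in> nbhd i" for i unfolding f_def by (rule someI[of _ i]) (simp add: nbhd_def)
    have "(i, j) \<in> E" if "f i = f j" "i \<noteq> j" for i j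
      using f[of i] f[of j] that True \<open>sym E\<close> unfolding nbhd_def by (auto dest: symD)
    moreover have "p \<in> block_prime V (vars S) f"
      using less.prems by (intro less.prems(6)) (auto simp: f_def dest: nbhd)
    ultimately show ?thesis using less.prems(1) by (intro block_prime_subset_cliques[where f = f]) auto
  next
    case False
    then obtain v i k where vik: "(i, v) \<in> E" "(v, k) \<in> E" "i \<noteq> k" "(i, k) \<notin> E" by blast
    then have v: "v \<in> V - S" using less.prems(3) by auto
    let ?E1 = "complete_at v E" and ?E2 = "E \<inter> (- {v}) \<times> (- {v})"
    have "p \<in> partial_edge_ideal V S ?E1"
    proof (rule less.hyps)
      have "(i, k) \<in> (V - S) \<times> (V - S) - E" "(i, k) \<in> ?E1" "E \<subseteq> ?E1"
        using vik less.prems(3) by (auto simp: complete_at_def)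
      then show "card ((V - S) \<times> (V - S) - ?E1) < card ((V - S) \<times> (V - S) - E)"
        using fin by (intro psubset_card_mono) auto
      show "?E1 \<subseteq> (V - S) \<times> (V - S)" using less.prems(3) by (auto simp: complete_at_def)
      show "sym ?E1" using \<open>sym E\<close> by (auto simp: complete_at_def sym_def)
      show "irrefl ?E1" using \<open>irrefl E\<close> by (auto simp: complete_at_def irrefl_def)
    next
      fix T and f :: "'v \<Rightarrow> 'v" assume "S \<subseteq> T" "T \<subseteq> V" "\<And>i j. (i, j) \<in> ?E1 \<Longrightarrow> i \<notin> T \<Longrightarrow> j \<notin> T \<Longrightarrow> f i = f j"
      then show "p \<in> block_prime V (vars T) f"
        by (intro less.prems(6)) (auto simp: complete_at_def)
    qed (use less.prems in auto)
    then have 1: "p - kill_vertex v p \<in> partial_edge_ideal V S E"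
      using less.prems(2,3) v by (intro completed_diff_kill_vertex)
    have "p \<in> partial_edge_ideal V (insert v S) ?E2"
    proof (rule less.hyps)
      have "(v, v) \<in> (V - S) \<times> (V - S) - E" using v \<open>irrefl E\<close> by (auto simp: irrefl_def)
      then show "card ((V - insert v S) \<times> (V - insert v S) - ?E2) < card ((V - S) \<times> (V - S) - E)"
        using fin by (intro psubset_card_mono) auto
      show "?E2 \<subseteq> (V - insert v S) \<times> (V - insert v S)" using less.prems(3) by auto
      show "sym ?E2" using \<open>sym E\<close> by (auto simp: sym_def)
      show "irrefl ?E2" using \<open>irrefl E\<close> by (auto simp: irrefl_def)
    next
      fix T and f :: "'v \<Rightarrow> 'v" assume "insert v S \<subseteq> T" "T \<subseteq> V" "\<And>i j. (i, j) \<in> ?E2 \<Longrightarrow> i \<notin> T \<Longrightarrow> j \<notin> T \<Longrightarrow> f i = f j"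
      then show "p \<in> block_prime V (vars T) f"
        by (intro less.prems(6)) auto
    qed (use less.prems v in auto)
    then have "kill_vertex v p \<in> partial_edge_ideal V S E" by (rule deleted_kill_vertex)
    from partial_edge_ideal_add[OF 1 this] show ?thesis by simp
  qed
qed

section \<open>Associated primes of a finite intersection of primes\<close>

text \<open>A product of elements of the ideals that lie outside the prime.\<close>

lemma separating_element:
  fixes P :: "('x, 'k :: comm_ring_1) mpoly set"
  assumes "finite \<Q>" "primeideal P (polynomial_ring A)"
    and "\<And>Q. Q \<in> \<Q> \<Longrightarrow> ideal Q (polynomial_ring A)" "\<And>Q. Q \<in> \<Q> \<Longrightarrow> \<not> Q \<subseteq> P"
  shows "\<exists>f\<in>Pol A. f \<notin> P \<and> (\<forall>Q\<in>\<Q>. f \<in> Q)"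
  using assms(1,3,4)
proof (induction \<Q> rule: finite_induct)
  case empty
  then show ?case using prime_polynomial_ringD(2)[OF assms(2)] by (intro bexI[of _ 1]) auto
next
  case (insert Q \<Q>)
  then obtain f where f: "f \<in> Pol A" "f \<notin> P" "\<forall>Q\<in>\<Q>. f \<in> Q" by blast
  obtain g where g: "g \<in> Q" "g \<notin> P" using insert.prems(2)[of Q] by blast
  have gA: "g \<in> Pol A" using g insert.prems(1)[of Q] ideal_polynomial_ringD(1) by blast
  have "f * g \<notin> P" using prime_polynomial_ringD(3)[OF assms(2) f(1) gA] f g by blast
  moreover have "f * g \<in> Q'" if "Q' \<in> insert Q \<Q>" for Q'
  proof -
    note mult = ideal_polynomial_ringD(4)[OF insert.prems(1)[OF that]]
    show ?thesis
      using mult[of g f] mult[of f g] that f g gA by (auto simp: mult.commute)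
  qed
  ultimately show ?case using f(1) gA by (intro bexI[of _ "f * g"]) auto
qed

text \<open>The colon ideal of \<open>f\<close> is the intersection of the members that do not contain \<open>f\<close>. If it is prime, it
  equals one of these members, and any smaller member does not contain \<open>f\<close> either. Conversely a minimal
  member \<open>P\<close> is the colon ideal of an element that lies in all members except \<open>P\<close>.\<close>

theorem associated_primes_Inter:
  fixes \<P> :: "('x, 'k :: comm_ring_1) mpoly set set"
  assumes fin: "finite \<P>" and prime: "\<And>P. P \<in> \<P> \<Longrightarrow> primeideal P (polynomial_ring A)"
  shows "associated_primes (polynomial_ring A) {p \<in> Pol A. \<forall>P\<in>\<P>. p \<in> P} =
    {P \<in> \<P>. \<forall>Q\<in>\<P>. Q \<subseteq> P \<longrightarrow> Q = P}"
proof -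
  have ideal: "ideal P (polynomial_ring A)" and sub: "P \<subseteq> Pol A" if "P \<in> \<P>" for P
    using prime_polynomial_ringD(1)[OF prime[OF that]] ideal_polynomial_ringD(1) by blast+
  have colon: "{r \<in> carrier (polynomial_ring A). r \<otimes>\<^bsub>polynomial_ring A\<^esub> f \<in> {p \<in> Pol A. \<forall>P\<in>\<P>. p \<in> P}}
      = {r \<in> Pol A. \<forall>P\<in>\<P>. f \<notin> P \<longrightarrow> r \<in> P}" if f: "f \<in> Pol A" for f
  proof -
    have "r * f \<in> P \<longleftrightarrow> (f \<notin> P \<longrightarrow> r \<in> P)" if "r \<in> Pol A" "P \<in> \<P>" for r P
      using prime_polynomial_ringD(3)[OF prime[OF that(2)] that(1) f]
        ideal_polynomial_ringD(4)[OF ideal[OF that(2)]] that f by (metis mult.commute)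
    then show ?thesis
      using f unfolding carrier_polynomial_ring polynomial_ring_simps(4) by auto
  qed
  show ?thesis
  proof (intro equalityI subsetI)
    fix P assume "P \<in> associated_primes (polynomial_ring A) {p \<in> Pol A. \<forall>P\<in>\<P>. p \<in> P}"
    then obtain f where P: "primeideal P (polynomial_ring A)" and f: "f \<in> Pol A"
      and P_eq: "P = {r \<in> Pol A. \<forall>Q\<in>\<P>. f \<notin> Q \<longrightarrow> r \<in> Q}"
      unfolding associated_primes_def using colon by (auto simp only: carrier_polynomial_ring)
    have "\<exists>Q\<in>\<P>. f \<notin> Q \<and> Q \<subseteq> P"
    proof (rule ccontr)
      assume "\<not> ?thesis"
      then have "\<exists>g\<in>Pol A. g \<notin> P \<and> (\<forall>Q\<in>{Q \<in> \<P>. f \<notin> Q}. g \<in> Q)"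
        using fin P ideal by (intro separating_element) auto
      then show False using P_eq by blast
    qed
    then obtain Q where Q: "Q \<in> \<P>" "f \<notin> Q" "Q \<subseteq> P" by blast
    then have "P = Q" using P_eq by blast
    moreover have "Q' = P" if "Q' \<in> \<P>" "Q' \<subseteq> P" for Q'
      using that Q \<open>P = Q\<close> P_eq by blast
    ultimately show "P \<in> {P \<in> \<P>. \<forall>Q\<in>\<P>. Q \<subseteq> P \<longrightarrow> Q = P}" using Q by blast
  next
    fix P assume P: "P \<in> {P \<in> \<P>. \<forall>Q\<in>\<P>. Q \<subseteq> P \<longrightarrow> Q = P}"
    then have "\<exists>f\<in>Pol A. f \<notin> P \<and> (\<forall>Q\<in>\<P> - {P}. f \<in> Q)"
      using fin prime ideal by (intro separating_element) auto
    then obtain f where f: "f \<in> Pol A" "f \<notin> P" "\<And>Q. Q \<in> \<P> \<Longrightarrow> Q \<noteq> P \<Longrightarrow> f \<in> Q" by blast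
    have "P = {r \<in> Pol A. \<forall>Q\<in>\<P>. f \<notin> Q \<longrightarrow> r \<in> Q}"
      using P f sub by blast
    then show "P \<in> associated_primes (polynomial_ring A) {p \<in> Pol A. \<forall>P\<in>\<P>. p \<in> P}"
      unfolding associated_primes_def using P f(1) prime colon[OF f(1)]
      by (auto simp only: carrier_polynomial_ring intro!: bexI[of _ f])
  qed
qed

section \<open>Cut sets\<close>

text \<open>Vertices of \<open>S\<close> reach only themselves; their classes are never counted.\<close>

definition reach :: "('v \<times> 'v) set \<Rightarrow> 'v set \<Rightarrow> ('v \<times> 'v) set" where
  "reach E S = (E \<inter> (- S) \<times> (- S))\<^sup>*"

definition num_components :: "'v set \<Rightarrow> ('v \<times> 'v) set \<Rightarrow> 'v set \<Rightarrow> nat" where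
  "num_components V E S = card ((\<lambda>i. reach E S `` {i}) ` (V - S))"

definition cut_set :: "'v set \<Rightarrow> ('v \<times> 'v) set \<Rightarrow> 'v set \<Rightarrow> bool" where
  "cut_set V E S \<longleftrightarrow> S \<subseteq> V \<and>
     (\<forall>i\<in>S. \<exists>j k. (i, j) \<in> E \<and> (i, k) \<in> E \<and> j \<notin> S \<and> k \<notin> S \<and> (j, k) \<notin> reach E S)"

text \<open>A vertex as the label of a component, since the parameters of \<open>block_prime\<close> are labelled by vertices.\<close>

definition component_rep :: "('v \<times> 'v) set \<Rightarrow> 'v set \<Rightarrow> 'v \<Rightarrow> 'v" where
  "component_rep E S i = (SOME j. (i, j) \<in> reach E S)"

lemma reach_refl [simp]: "(i, i) \<in> reach E S"
  by (simp add: reach_def)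

lemma reach_trans: "(i, j) \<in> reach E S \<Longrightarrow> (j, k) \<in> reach E S \<Longrightarrow> (i, k) \<in> reach E S"
  unfolding reach_def by (rule rtrancl_trans)

lemma reach_edge: "(i, j) \<in> E \<Longrightarrow> i \<notin> S \<Longrightarrow> j \<notin> S \<Longrightarrow> (i, j) \<in> reach E S"
  unfolding reach_def by blast

lemma reach_mono: "E \<subseteq> E' \<Longrightarrow> T \<subseteq> S \<Longrightarrow> reach E S \<subseteq> reach E' T"
  unfolding reach_def by (intro rtrancl_mono) auto

lemma reach_sym: "sym E \<Longrightarrow> (i, j) \<in> reach E S \<Longrightarrow> (j, i) \<in> reach E S"
  unfolding reach_def by (rule symD[OF sym_rtrancl]) (auto simp: sym_def)

lemma reach_induct [consumes 1, case_names refl step]: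
  assumes "(i, j) \<in> reach E S" "P i"
    and "\<And>j k. (i, j) \<in> reach E S \<Longrightarrow> (j, k) \<in> E \<Longrightarrow> j \<notin> S \<Longrightarrow> k \<notin> S \<Longrightarrow> P j \<Longrightarrow> P k"
  shows "P j"
  using assms(1) unfolding reach_def
  by (induction rule: rtrancl_induct) (auto intro: assms simp: reach_def)

lemma reach_class_eq_iff:
  assumes "sym E"
  shows "reach E S `` {i} = reach E S `` {j} \<longleftrightarrow> (i, j) \<in> reach E S"
proof
  assume "reach E S `` {i} = reach E S `` {j}"
  then have "j \<in> reach E S `` {i}" by simp
  then show "(i, j) \<in> reach E S" by simp
next
  assume ij: "(i, j) \<in> reach E S"
  then show "reach E S `` {i} = reach E S `` {j}"
    using reach_sym[OF assms ij] reach_trans[of _ _ E S] by blast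
qed

lemma component_rep_eq_iff:
  assumes "sym E"
  shows "component_rep E S i = component_rep E S j \<longleftrightarrow> (i, j) \<in> reach E S"
proof
  have rep: "(i, component_rep E S i) \<in> reach E S" for i
    unfolding component_rep_def by (rule someI[of _ i]) simp
  assume "component_rep E S i = component_rep E S j"
  then show "(i, j) \<in> reach E S"
    using rep[of i] rep[of j] reach_sym[OF assms] reach_trans[of _ _ E S] by metis
next
  assume "(i, j) \<in> reach E S"
  then have "(i, k) \<in> reach E S \<longleftrightarrow> (j, k) \<in> reach E S" for k
    using reach_sym[OF assms] reach_trans[of _ _ E S] by blast
  then show "component_rep E S i = component_rep E S j" by (simp add: component_rep_def)
qed

text \<open>Lets classes be counted through any function that separates them.\<close>

lemma card_image_same_kernel:
  assumes "\<And>x y. x \<in> B \<Longrightarrow> y \<in> B \<Longrightarrow> f x = f y \<longleftrightarrow> g x = g y"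
  shows "card (f ` B) = card (g ` B)"
proof -
  define h where "h c = g (inv_into B f c)" for c
  have h: "h (f x) = g x" if "x \<in> B" for x
    using assms[of "inv_into B f (f x)" x] that by (auto simp: h_def inv_into_into f_inv_into_f)
  then have "g ` B = h ` f ` B" by (auto simp: image_image intro!: image_cong)
  moreover have "inj_on h (f ` B)"
    using assms h by (auto simp: inj_on_def)
  ultimately show ?thesis by (simp add: card_image)
qed

lemma card_component_rep:
  assumes "sym E"
  shows "card (component_rep E S ` (V - S)) = num_components V E S"
  unfolding num_components_def
  by (intro card_image_same_kernel) (simp add: component_rep_eq_iff reach_class_eq_iff assms)

section \<open>The associated primes of a binomial edge ideal\<close>

definition component_prime ::
    "'v set \<Rightarrow> ('v \<times> 'v) set \<Rightarrow> 'v set \<Rightarrow> ('v edge_var, 'k :: comm_ring_1) mpoly set" where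
  "component_prime V E S = block_prime V (vars S) (component_rep E S)"

lemma edge_ideal_subset_component_prime:
  fixes V :: "'v :: linorder set" and p :: "('v edge_var, 'k :: field) mpoly"
  assumes "E \<subseteq> V \<times> V" "sym E" "p \<in> partial_edge_ideal V {} E"
  shows "p \<in> component_prime V E S"
proof -
  note I = ideal_polynomial_ringD[OF prime_polynomial_ringD(1)[OF prime_block_prime[of V "vars S" "component_rep E S"]]]
  show ?thesis using assms(3) unfolding component_prime_def
  proof (induction rule: partial_edge_ideal_induct)
    case (edge i j q)
    then have "edge_binomial i j \<in> (block_prime V (vars S) (component_rep E S) :: ('v edge_var, 'k) mpoly set)"
      using assms(1) by (subst edge_binomial_in_block_prime)
        (auto simp: component_rep_eq_iff[OF assms(2)] intro: reach_edge)
    then show ?case using edge by (intro I)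
  qed (use I in auto)
qed

text \<open>The components form the finest partition of the vertices outside \<open>T\<close> that is compatible with the edges, so the
  component prime is contained in every prime that the decomposition needs for the same \<open>T\<close>.\<close>

theorem edge_ideal_eq_Inter:
  fixes V :: "'v :: linorder set"
  assumes "finite V" "E \<subseteq> V \<times> V" "sym E" "irrefl E"
  shows "partial_edge_ideal V {} E = {p \<in> Pol (vars V). \<forall>S\<in>Pow V. p \<in> (component_prime V E S :: ('v edge_var, 'k :: field) mpoly set)}"
proof (intro equalityI subsetI)
  fix p :: "('v edge_var, 'k) mpoly" assume p: "p \<in> partial_edge_ideal V {} E"
  then show "p \<in> {p \<in> Pol (vars V). \<forall>S\<in>Pow V. p \<in> component_prime V E S}"
    using edge_ideal_subset_component_prime[OF assms(2,3) p]
    by (auto simp: component_prime_def block_prime_def ker_def)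
next
  fix p :: "('v edge_var, 'k) mpoly" assume p: "p \<in> {p \<in> Pol (vars V). \<forall>S\<in>Pow V. p \<in> component_prime V E S}"
  show "p \<in> partial_edge_ideal V {} E"
  proof (rule partial_edge_ideal_decomposition)
    fix T and f :: "'v \<Rightarrow> 'v"
    assume T: "T \<subseteq> V" and f: "\<And>i j. (i, j) \<in> E \<Longrightarrow> i \<notin> T \<Longrightarrow> j \<notin> T \<Longrightarrow> f i = f j"
    have "f i = f j" if "(i, j) \<in> reach E T" for i j
      using that by (induction rule: reach_induct) (auto dest: f)
    then have "block_prime V (vars T) (component_rep E T) \<subseteq> (block_prime V (vars T) f :: ('v edge_var, 'k) mpoly set)"
      by (intro block_prime_mono) (auto simp: component_rep_eq_iff[OF assms(3)])
    then show "p \<in> block_prime V (vars T) f" using p T by (auto simp: component_prime_def)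
  qed (use assms in auto)
qed

text \<open>The variables and the edge binomials in a component prime determine the removed set and the components.\<close>

lemma component_prime_subset_iff:
  assumes "S \<subseteq> V" "T \<subseteq> V" "sym E"
  shows "component_prime V E T \<subseteq> (component_prime V E S :: ('v edge_var, 'k :: comm_ring_1) mpoly set) \<longleftrightarrow>
    T \<subseteq> S \<and> (\<forall>i\<in>V - S. \<forall>j\<in>V - S. (i, j) \<in> reach E T \<longrightarrow> (i, j) \<in> reach E S)"
proof
  assume sub: "component_prime V E T \<subseteq> (component_prime V E S :: ('v edge_var, 'k) mpoly set)"
  have "T \<subseteq> S"
  proof
    fix i assume i: "i \<in> T"
    then have "mvar (XVar i) \<in> (component_prime V E T :: ('v edge_var, 'k) mpoly set)"
      using assms by (auto simp: component_prime_def variable_in_block_prime)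
    then have "mvar (XVar i) \<in> (component_prime V E S :: ('v edge_var, 'k) mpoly set)"
      using sub by blast
    moreover have "XVar i \<in> vars V" using i assms(2) by auto
    ultimately show "i \<in> S" by (simp add: component_prime_def variable_in_block_prime)
  qed
  moreover have "(i, j) \<in> reach E S" if "i \<in> V - S" "j \<in> V - S" "(i, j) \<in> reach E T" for i j
  proof -
    have "edge_binomial i j \<in> (component_prime V E T :: ('v edge_var, 'k) mpoly set)"
      using that by (simp add: component_prime_def edge_binomial_in_block_prime component_rep_eq_iff[OF assms(3)])
    then have "edge_binomial i j \<in> (component_prime V E S :: ('v edge_var, 'k) mpoly set)"
      using sub by blast
    then show ?thesis
      using that by (simp add: component_prime_def edge_binomial_in_block_prime component_rep_eq_iff[OF assms(3)])
  qed
  ultimately show "T \<subseteq> S \<and> (\<forall>i\<in>V - S. \<forall>j\<in>V - S. (i, j) \<in> reach E T \<longrightarrow> (i, j) \<in> reach E S)" by blast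
next
  assume "T \<subseteq> S \<and> (\<forall>i\<in>V - S. \<forall>j\<in>V - S. (i, j) \<in> reach E T \<longrightarrow> (i, j) \<in> reach E S)"
  then show "component_prime V E T \<subseteq> (component_prime V E S :: ('v edge_var, 'k) mpoly set)"
    unfolding component_prime_def by (intro block_prime_mono) (auto simp: component_rep_eq_iff[OF assms(3)])
qed

text \<open>If \<open>i \<in> S\<close> has neighbours in at most one component of \<open>G - S\<close>, putting \<open>i\<close> back merges no components, and the
  prime of \<open>S - {i}\<close> is strictly smaller. If \<open>i\<close> has neighbours in two components, then a set \<open>T \<subseteq> S\<close> without \<open>i\<close>
  connects these components through \<open>i\<close>.\<close>

lemma minimal_component_prime_iff:
  assumes "S \<subseteq> V" "E \<subseteq> V \<times> V" "sym E" "irrefl E"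
  shows "(\<forall>T\<in>Pow V. component_prime V E T \<subseteq> (component_prime V E S :: ('v edge_var, 'k :: comm_ring_1) mpoly set) \<longrightarrow>
      component_prime V E T = (component_prime V E S :: ('v edge_var, 'k) mpoly set)) \<longleftrightarrow> cut_set V E S"
proof
  assume cut: "cut_set V E S"
  show "\<forall>T\<in>Pow V. component_prime V E T \<subseteq> (component_prime V E S :: ('v edge_var, 'k) mpoly set) \<longrightarrow>
      component_prime V E T = (component_prime V E S :: ('v edge_var, 'k) mpoly set)"
  proof safe
    fix T assume "T \<subseteq> V" and "component_prime V E T \<subseteq> (component_prime V E S :: ('v edge_var, 'k) mpoly set)"
    then have T: "T \<subseteq> S" "\<And>i j. i \<in> V - S \<Longrightarrow> j \<in> V - S \<Longrightarrow> (i, j) \<in> reach E T \<Longrightarrow> (i, j) \<in> reach E S"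
      unfolding component_prime_subset_iff[OF assms(1) \<open>T \<subseteq> V\<close> assms(3)] by blast+
    have "S \<subseteq> T"
    proof (rule ccontr)
      assume "\<not> S \<subseteq> T"
      then obtain i where i: "i \<in> S" "i \<notin> T" by blast
      then obtain j k where jk: "(i, j) \<in> E" "(i, k) \<in> E" "j \<notin> S" "k \<notin> S" "(j, k) \<notin> reach E S"
        using cut by (auto simp: cut_set_def)
      then have "(j, i) \<in> reach E T" "(i, k) \<in> reach E T"
        using i T(1) \<open>sym E\<close> by (auto intro!: reach_edge dest: symD)
      then show False using T(2)[of j k] jk assms(2) by (auto dest: reach_trans)
    qed
    then have "T = S" using T(1) by blast
    then show "p \<in> component_prime V E T" if "p \<in> component_prime V E S" for p :: "('v edge_var, 'k) mpoly"
      using that by simp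
  qed
next
  assume min: "\<forall>T\<in>Pow V. component_prime V E T \<subseteq> (component_prime V E S :: ('v edge_var, 'k) mpoly set) \<longrightarrow>
      component_prime V E T = (component_prime V E S :: ('v edge_var, 'k) mpoly set)"
  show "cut_set V E S"
    unfolding cut_set_def
  proof (intro conjI ballI assms(1), rule ccontr)
    fix i assume i: "i \<in> S"
    assume no: "\<not> (\<exists>j k. (i, j) \<in> E \<and> (i, k) \<in> E \<and> j \<notin> S \<and> k \<notin> S \<and> (j, k) \<notin> reach E S)"
    let ?T = "S - {i}"
    \<comment> \<open>A path that passes through \<open>i\<close> leaves and re-enters the same component of \<open>G - S\<close>.\<close>
    have "b \<noteq> i \<and> (a, b) \<in> reach E S \<or> b = i \<and> (\<exists>j. (i, j) \<in> E \<and> j \<notin> S \<and> (a, j) \<in> reach E S)"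
      if "(a, b) \<in> reach E ?T" "a \<notin> S" for a b
      using that
    proof (induction rule: reach_induct)
      case refl
      then show ?case using i by auto
    next
      case (step b c)
      show ?case
      proof (cases "b = i")
        case True
        then obtain j where j: "(i, j) \<in> E" "j \<notin> S" "(a, j) \<in> reach E S" using step by blast
        have "c \<noteq> i" using step True \<open>irrefl E\<close> by (auto simp: irrefl_def)
        then have "(j, c) \<in> reach E S" using no j step True by blast
        then show ?thesis using reach_trans[OF j(3)] \<open>c \<noteq> i\<close> by blast
      next
        case False
        then have b: "(a, b) \<in> reach E S" "b \<notin> S" using step by auto
        show ?thesis
        proof (cases "c = i")
          case True
          then show ?thesis using b step \<open>sym E\<close> by (auto dest: symD)
        next
          case False
          then have "(b, c) \<in> reach E S" using b step by (auto intro: reach_edge)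
          then show ?thesis using reach_trans[OF b(1)] False by blast
        qed
      qed
    qed
    then have "component_prime V E ?T \<subseteq> (component_prime V E S :: ('v edge_var, 'k) mpoly set)"
      using assms(1) i by (subst component_prime_subset_iff[OF assms(1) _ assms(3)]) blast+
    then have "component_prime V E S \<subseteq> (component_prime V E ?T :: ('v edge_var, 'k) mpoly set)"
      using min assms(1) by (metis Diff_subset PowI order_refl subset_trans)
    then have "S \<subseteq> ?T" using assms component_prime_subset_iff[of ?T V S E] by auto
    then show False using i by blast
  qed
qed

theorem associated_primes_edge_ideal:
  fixes V :: "'v :: linorder set"
  assumes "finite V" "E \<subseteq> V \<times> V" "sym E" "irrefl E"
  shows "associated_primes (polynomial_ring (vars V)) (partial_edge_ideal V {} E :: ('v edge_var, 'k :: field) mpoly set)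
    = component_prime V E ` {S. cut_set V E S}"
proof -
  let ?P = "component_prime V E ` Pow V :: ('v edge_var, 'k) mpoly set set"
  have "partial_edge_ideal V {} E = {p \<in> Pol (vars V). \<forall>P\<in>?P. p \<in> P}"
    using edge_ideal_eq_Inter[OF assms] by simp
  then have "associated_primes (polynomial_ring (vars V)) (partial_edge_ideal V {} E :: ('v edge_var, 'k) mpoly set)
      = {P \<in> ?P. \<forall>Q\<in>?P. Q \<subseteq> P \<longrightarrow> Q = P}"
    using assms(1) by (simp only:) (intro associated_primes_Inter, auto simp: component_prime_def prime_block_prime)
  also have "\<dots> = component_prime V E ` {S \<in> Pow V. \<forall>T\<in>Pow V. component_prime V E T \<subseteq> (component_prime V E S :: ('v edge_var, 'k) mpoly set) \<longrightarrow>
      component_prime V E T = (component_prime V E S :: ('v edge_var, 'k) mpoly set)}"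
  proof -
    have "{P \<in> f ` X. \<forall>Q\<in>f ` X. R Q P} = f ` {S \<in> X. \<forall>T\<in>X. R (f T) (f S)}"
      for f :: "'v set \<Rightarrow> ('v edge_var, 'k) mpoly set" and X R
      by auto
    then show ?thesis .
  qed
  also have "{S \<in> Pow V. \<forall>T\<in>Pow V. component_prime V E T \<subseteq> (component_prime V E S :: ('v edge_var, 'k) mpoly set) \<longrightarrow>
      component_prime V E T = (component_prime V E S :: ('v edge_var, 'k) mpoly set)} = {S. cut_set V E S}"
  proof (intro Collect_cong)
    fix S
    have "cut_set V E S \<Longrightarrow> S \<subseteq> V" by (simp add: cut_set_def)
    then show "(S \<in> Pow V \<and> (\<forall>T\<in>Pow V. component_prime V E T \<subseteq> (component_prime V E S :: ('v edge_var, 'k) mpoly set) \<longrightarrow>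
      component_prime V E T = (component_prime V E S :: ('v edge_var, 'k) mpoly set))) = cut_set V E S"
      using minimal_component_prime_iff[OF _ assms(2-4), where 'k = 'k, of S] by blast
  qed
  finally show ?thesis .
qed

lemma num_components_empty:
  assumes "V \<noteq> {}" "\<And>i j. i \<in> V \<Longrightarrow> j \<in> V \<Longrightarrow> (i, j) \<in> E\<^sup>*" "sym E"
  shows "num_components V E {} = 1"
proof -
  obtain i where i: "i \<in> V" using assms(1) by blast
  have "reach E {} `` {j} = reach E {} `` {i}" if "j \<in> V" for j
    using assms(2)[OF that i] by (subst reach_class_eq_iff[OF assms(3)]) (simp add: reach_def)
  then have "(\<lambda>j. reach E {} `` {j}) ` (V - {}) = (\<lambda>_. reach E {} `` {i}) ` V"
    by (intro image_cong) simp_all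
  then show ?thesis using assms(1) by (simp add: num_components_def image_constant_conv)
qed

text \<open>The empty cut set gives the height \<open>|V| - 1\<close>, with which all others are compared.\<close>

theorem unmixed_edge_ideal_iff:
  fixes V :: "'v :: linorder set"
  assumes V: "finite V" "V \<noteq> {}" and E: "E \<subseteq> V \<times> V" "sym E" "irrefl E"
    and conn: "\<And>i j. i \<in> V \<Longrightarrow> j \<in> V \<Longrightarrow> (i, j) \<in> E\<^sup>*"
  shows "unmixed (polynomial_ring (vars V)) (partial_edge_ideal V {} E :: ('v edge_var, 'k :: field) mpoly set)
    \<longleftrightarrow> (\<forall>S. cut_set V E S \<longrightarrow> num_components V E S = card S + 1)"
proof -
  let ?h = "\<lambda>S. 2 * card S + (card (V - S) - num_components V E S)"
  have height: "height (polynomial_ring (vars V)) (component_prime V E S :: ('v edge_var, 'k) mpoly set) = enat (?h S)"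
    if "cut_set V E S" for S
    using that V E(2) by (simp add: component_prime_def height_block_prime card_component_rep cut_set_def)
  have empty: "cut_set V E {}" by (simp add: cut_set_def)
  have "?h S = ?h {} \<longleftrightarrow> num_components V E S = card S + 1" if "cut_set V E S" for S
  proof -
    have S: "S \<subseteq> V" using that by (simp add: cut_set_def)
    have "num_components V E S \<le> card (V - S)"
      unfolding num_components_def using V by (intro card_image_le) auto
    moreover have "card V = card S + card (V - S)"
      using V S by (metis card_Diff_subset card_mono finite_subset le_add_diff_inverse)
    moreover have "card V \<noteq> 0" using V by simp
    ultimately show ?thesis using num_components_empty[OF V(2) conn E(2)] by simp linarith
  qed
  moreover have "unmixed (polynomial_ring (vars V)) (partial_edge_ideal V {} E :: ('v edge_var, 'k) mpoly set)
    \<longleftrightarrow> (\<forall>S. cut_set V E S \<longrightarrow> ?h S = ?h {})"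
  proof -
    have "unmixed (polynomial_ring (vars V)) (partial_edge_ideal V {} E :: ('v edge_var, 'k) mpoly set)
      \<longleftrightarrow> (\<forall>S T. cut_set V E S \<longrightarrow> cut_set V E T \<longrightarrow> enat (?h S) = enat (?h T))"
      unfolding unmixed_def associated_primes_edge_ideal[OF V(1) E] ball_simps mem_Collect_eq
      by (simp only: height cong: imp_cong) blast
    also have "\<dots> \<longleftrightarrow> (\<forall>S. cut_set V E S \<longrightarrow> ?h S = ?h {})"
    proof (intro iffI allI impI)
      fix S assume "\<forall>S T. cut_set V E S \<longrightarrow> cut_set V E T \<longrightarrow> enat (?h S) = enat (?h T)" "cut_set V E S"
      then have "enat (?h S) = enat (?h {})" using empty by blast
      then show "?h S = ?h {}" by (simp only: enat.inject)
    next
      fix S T assume "\<forall>S. cut_set V E S \<longrightarrow> ?h S = ?h {}" "cut_set V E S" "cut_set V E T"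
      then have "?h S = ?h {}" "?h T = ?h {}" by blast+
      then show "enat (?h S) = enat (?h T)" by (simp only:)
    qed
    finally show ?thesis .
  qed
  ultimately show ?thesis by blast
qed

text \<open>The restriction \<open>i < j\<close> selects one of the two generators \<open>\<plusminus> f\<^sub>i\<^sub>j\<close> of each edge.\<close>

lemma binomial_edge_ideal_eq:
  assumes "pair_graph G"
  shows "binomial_edge_ideal G = (partial_edge_ideal (pverts G) {} (parcs G) :: ('v :: linorder edge_var, 'k :: field) mpoly set)"
    and "(edge_ring G :: ('v edge_var, 'k) mpoly ring) = polynomial_ring (vars (pverts G))"
proof -
  interpret pair_graph G by fact
  show ring: "(edge_ring G :: ('v edge_var, 'k) mpoly ring) = polynomial_ring (vars (pverts G))"
    by (simp add: edge_ring_def vars_def)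
  let ?A = "vars (pverts G)"
  let ?F = "{edge_binomial i j | i j. (i, j) \<in> parcs G \<and> i < j} :: ('v edge_var, 'k) mpoly set"
  let ?F' = "{edge_binomial i j | i j. (i, j) \<in> parcs G} :: ('v edge_var, 'k) mpoly set"
  have "?F \<subseteq> Pol ?A" by (auto intro!: edge_binomial_Pol dest: in_arcsD1 in_arcsD2)
  then have "binomial_edge_ideal G = generated ?A ?F"
    unfolding binomial_edge_ideal_def ring edge_binomial_def[symmetric] by (rule genideal_polynomial_ring)
  also have "\<dots> = generated ?A ?F'"
  proof (intro equalityI subsetI)
    fix p assume "p \<in> generated ?A ?F'"
    moreover have "f \<in> generated ?A ?F" if f: "f \<in> ?F'" for f
    proof -
      obtain i j :: 'v where ij: "(i, j) \<in> parcs G" "f = edge_binomial i j" using f by auto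
      then have "i \<noteq> j" "(j, i) \<in> parcs G"
        using pair_no_loops[of "(i, j)"] pair_sym_arcs by (auto simp: symmetric_def dest: symD)
      then consider "i < j" | "j < i" "f = - edge_binomial j i"
        using ij(2) by (cases "i < j") (auto simp: edge_binomial_def)
      then show ?thesis
      proof cases
        case 1
        then show ?thesis using ij by (intro generated_base) auto
      next
        case 2
        show ?thesis unfolding 2(2)
          using 2(1) \<open>(j, i) \<in> parcs G\<close> by (intro generated_uminus generated_base) auto
      qed
    qed
    ultimately show "p \<in> generated ?A ?F" by (rule generated_subset[rotated])
  next
    fix p assume "p \<in> generated ?A ?F"
    then show "p \<in> generated ?A ?F'" by (rule generated_subset[rotated]) (auto intro: generated_base)
  qed
  finally show "binomial_edge_ideal G = (partial_edge_ideal (pverts G) {} (parcs G) :: ('v edge_var, 'k) mpoly set)"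
    by (simp add: partial_edge_ideal_def)
qed

section \<open>Gluing two graphs at a free vertex\<close>

lemma reach_restrict:
  assumes "E \<subseteq> V \<times> V" "S \<inter> V = T \<inter> V"
  shows "reach E S = reach E T"
  unfolding reach_def using assms by (intro arg_cong[of _ _ rtrancl]) auto

lemma num_components_restrict:
  assumes "E \<subseteq> V \<times> V" "S \<inter> V = T \<inter> V"
  shows "num_components V E S = num_components V E T"
proof -
  have "V - S = V - T" using assms(2) by blast
  then show ?thesis by (simp add: num_components_def reach_restrict[OF assms])
qed

text \<open>The neighbours of \<open>v\<close> form a clique. A free vertex of the clique complex has this property
  (\<open>free_vertex_simplicial\<close>).\<close>

definition simplicial :: "('v \<times> 'v) set \<Rightarrow> 'v \<Rightarrow> bool" where
  "simplicial E v \<longleftrightarrow> (\<forall>j k. (v, j) \<in> E \<longrightarrow> (v, k) \<in> E \<longrightarrow> j \<noteq> k \<longrightarrow> (j, k) \<in> E)"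

lemma simplicial_not_in_cut_set:
  assumes "simplicial E v" "cut_set V E S"
  shows "v \<notin> S"
proof
  assume "v \<in> S"
  then obtain j k where "(v, j) \<in> E" "(v, k) \<in> E" "j \<notin> S" "k \<notin> S" "(j, k) \<notin> reach E S"
    using assms(2) by (auto simp: cut_set_def)
  then show False using assms(1) by (cases "j = k") (auto simp: simplicial_def intro: reach_edge)
qed

text \<open>A path through \<open>v\<close> can take the edge between the neighbours of \<open>v\<close> before and after it.\<close>

lemma reach_remove_simplicial:
  assumes "simplicial E v" "sym E" "irrefl E" "j \<noteq> v" "k \<noteq> v"
  shows "(j, k) \<in> reach E (insert v S) \<longleftrightarrow> (j, k) \<in> reach E S"
proof
  assume "(j, k) \<in> reach E (insert v S)"
  then show "(j, k) \<in> reach E S" using reach_mono[of E E S "insert v S"] by blast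
next
  let ?R = "reach E (insert v S)"
  assume "(j, k) \<in> reach E S"
  then have "k \<noteq> v \<and> (j, k) \<in> ?R \<or> k = v \<and> (\<exists>u. u \<notin> insert v S \<and> (v, u) \<in> E \<and> (j, u) \<in> ?R)"
  proof (induction rule: reach_induct)
    case refl
    then show ?case using \<open>j \<noteq> v\<close> by simp
  next
    case (step k l)
    show ?case
    proof (cases "k = v")
      case True
      then obtain u where u: "u \<notin> insert v S" "(v, u) \<in> E" "(j, u) \<in> ?R" using step by blast
      have l: "l \<noteq> v" using step True \<open>irrefl E\<close> by (auto simp: irrefl_def)
      then have "(u, l) \<in> ?R"
        using assms(1) u step True by (cases "u = l") (auto simp: simplicial_def intro!: reach_edge)
      then show ?thesis using reach_trans[OF u(3)] l by blast
    next
      case False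
      then have k: "(j, k) \<in> ?R" using step by blast
      show ?thesis
      proof (cases "l = v")
        case True
        then show ?thesis using k step False \<open>sym E\<close> by (auto dest: symD)
      next
        case l: False
        then have "(k, l) \<in> ?R" using step False by (auto intro!: reach_edge)
        then show ?thesis using reach_trans[OF k] l by blast
      qed
    qed
  qed
  then show "(j, k) \<in> ?R" using \<open>k \<noteq> v\<close> by blast
qed

text \<open>The component of \<open>v\<close> survives the removal of \<open>v\<close> because it contains \<open>u\<close>.\<close>

lemma num_components_remove_simplicial:
  assumes "simplicial E v" "sym E" "irrefl E" "(v, u) \<in> E" "v \<in> V" "u \<in> V" "u \<notin> S" "v \<notin> S"
  shows "num_components V E (insert v S) = num_components V E S"
proof -
  have "u \<noteq> v" using assms by (auto simp: irrefl_def)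
  let ?C = "\<lambda>i. reach E S `` {i}"
  have "?C v = ?C u"
    unfolding reach_class_eq_iff[OF assms(2)] using assms by (intro reach_edge)
  moreover have "V - S = insert v (V - insert v S)" "u \<in> V - insert v S" using assms \<open>u \<noteq> v\<close> by auto
  ultimately have "?C ` (V - S) = ?C ` (V - insert v S)" by auto
  moreover have "card ((\<lambda>i. reach E (insert v S) `` {i}) ` (V - insert v S)) = card (?C ` (V - insert v S))"
    by (intro card_image_same_kernel)
      (simp add: reach_class_eq_iff[OF assms(2)] reach_remove_simplicial[OF assms(1-3)])
  ultimately show ?thesis unfolding num_components_def by simp
qed

locale gluing =
  fixes V1 V2 :: "'v set" and E1 E2 :: "('v \<times> 'v) set" and v :: 'v
  assumes finite: "finite V1" "finite V2"
    and edges: "E1 \<subseteq> V1 \<times> V1" "E2 \<subseteq> V2 \<times> V2"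
    and sym: "sym E1" "sym E2" and irrefl: "irrefl E1" "irrefl E2"
    and common: "V1 \<inter> V2 = {v}"
    and free: "simplicial E1 v" "simplicial E2 v"
begin

abbreviation "V \<equiv> V1 \<union> V2"
abbreviation "E \<equiv> E1 \<union> E2"

lemma swap: "gluing V2 V1 E2 E1 v"
  using finite edges sym irrefl common free by unfold_locales auto

lemma sym_E: "sym E"
  using sym by (auto simp: sym_def)

text \<open>A path can change sides only at \<open>v\<close>.\<close>

lemma reach_from_left:
  assumes "(i, j) \<in> reach E S" "i \<in> V1"
  shows "(j \<in> V1 \<and> (i, j) \<in> reach E1 S) \<or> (j \<in> V2 \<and> v \<notin> S \<and> (i, v) \<in> reach E1 S \<and> (v, j) \<in> reach E2 S)"
  using assms
proof (induction rule: reach_induct)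
  case (step j k)
  have at_v: "j = v" if "j \<in> V1" "j \<in> V2" using that common by blast
  from step.IH[OF step.prems] step.hyps(2) consider
    "j \<in> V1" "(i, j) \<in> reach E1 S" "(j, k) \<in> E1" | "j = v" "(i, v) \<in> reach E1 S" "(v, k) \<in> E2"
    | "v \<notin> S" "(i, v) \<in> reach E1 S" "(v, j) \<in> reach E2 S" "(j, k) \<in> E2"
    | "j = v" "(i, v) \<in> reach E1 S" "(v, k) \<in> E1"
    using at_v edges by blast
  then show ?case
  proof cases
    case 1
    then have "(i, k) \<in> reach E1 S" using step by (meson reach_edge reach_trans)
    then show ?thesis using 1 edges by blast
  next
    case 2
    then have "(v, k) \<in> reach E2 S" using step by (auto intro: reach_edge)
    then show ?thesis using 2 step edges by blast
  next
    case 3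
    then have "(v, k) \<in> reach E2 S" using step by (meson reach_edge reach_trans)
    then show ?thesis using 3 edges by blast
  next
    case 4
    then have "(i, k) \<in> reach E1 S" using step by (meson reach_edge reach_trans)
    then show ?thesis using 4 edges by blast
  qed
qed simp

lemma reach_left_iff:
  assumes "i \<in> V1" "j \<in> V1"
  shows "(i, j) \<in> reach E S \<longleftrightarrow> (i, j) \<in> reach E1 S"
proof
  assume "(i, j) \<in> reach E S"
  moreover have "j = v" if "j \<in> V2" using that assms(2) common by blast
  ultimately show "(i, j) \<in> reach E1 S" using reach_from_left[of i j S] assms by auto
next
  assume "(i, j) \<in> reach E1 S"
  then show "(i, j) \<in> reach E S" using reach_mono[of E1 E S S] by blast
qed

lemma reach_right_iff: "i \<in> V2 \<Longrightarrow> j \<in> V2 \<Longrightarrow> (i, j) \<in> reach E S \<longleftrightarrow> (i, j) \<in> reach E2 S"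
  using gluing.reach_left_iff[OF swap, of i j S] by (simp only: Un_commute[of E2 E1])

text \<open>A component of \<open>G - S\<close> that meets both sides contains \<open>v\<close>; there is one if \<open>v \<notin> S\<close> and none otherwise.\<close>

lemma num_components_gluing:
  "num_components V E S + (if v \<in> S then 0 else 1) = num_components V1 E1 S + num_components V2 E2 S"
proof -
  let ?C = "\<lambda>i. reach E S `` {i}"
  let ?A1 = "?C ` (V1 - S)" and ?A2 = "?C ` (V2 - S)"
  have A1: "card ?A1 = num_components V1 E1 S"
    unfolding num_components_def
    by (intro card_image_same_kernel)
      (simp only: reach_class_eq_iff[OF sym_E] reach_class_eq_iff[OF sym(1)] reach_left_iff Diff_iff)
  have A2: "card ?A2 = num_components V2 E2 S"
    unfolding num_components_def
    by (intro card_image_same_kernel)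
      (simp only: reach_class_eq_iff[OF sym_E] reach_class_eq_iff[OF sym(2)] reach_right_iff Diff_iff)
  have meet: "?A1 \<inter> ?A2 = (if v \<in> S then {} else {?C v})"
  proof -
    have "v \<notin> S \<and> ?C i = ?C v" if ij: "i \<in> V1 - S" "j \<in> V2 - S" "?C i = ?C j" for i j
    proof -
      have ij': "(i, j) \<in> reach E S" using ij(3) reach_class_eq_iff[OF sym_E] by metis
      have v: "v \<in> V1" "v \<in> V2" using common by auto
      have "j = v" if "j \<in> V1" using that ij(2) common by blast
      then have "v \<notin> S \<and> (i, v) \<in> reach E1 S" using reach_from_left[OF ij'] ij by auto
      then show ?thesis
        using ij(1) v(1) reach_left_iff[of i v S] reach_class_eq_iff[OF sym_E, of S i v] by blast
    qed
    then have "?A1 \<inter> ?A2 \<subseteq> (if v \<in> S then {} else {?C v})" by auto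
    moreover have "?C v \<in> ?A1 \<inter> ?A2" if "v \<notin> S" using that common by blast
    ultimately show ?thesis by (cases "v \<in> S") (simp_all only: if_True if_False subset_empty, blast)
  qed
  have "num_components V E S = card (?A1 \<union> ?A2)"
    by (simp add: num_components_def Un_Diff image_Un)
  moreover have "card ?A1 + card ?A2 = card (?A1 \<union> ?A2) + card (?A1 \<inter> ?A2)"
    using finite by (intro card_Un_Int) auto
  ultimately show ?thesis using A1 A2 meet by auto
qed

lemma cut_set_of_left:
  assumes "cut_set V1 E1 S"
  shows "cut_set V E S"
  unfolding cut_set_def
proof (intro conjI ballI)
  show "S \<subseteq> V" using assms by (auto simp: cut_set_def)
  fix i assume "i \<in> S"
  then obtain j k where jk: "(i, j) \<in> E1" "(i, k) \<in> E1" "j \<notin> S" "k \<notin> S" "(j, k) \<notin> reach E1 S"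
    using assms by (auto simp: cut_set_def)
  then have "(j, k) \<notin> reach E S" using reach_left_iff[of j k S] edges by blast
  then show "\<exists>j k. (i, j) \<in> E \<and> (i, k) \<in> E \<and> j \<notin> S \<and> k \<notin> S \<and> (j, k) \<notin> reach E S"
    using jk by blast
qed

text \<open>If \<open>v \<in> S\<close>, it is put back into \<open>G\<^sub>1\<close>, which joins no components because \<open>v\<close> is simplicial there.\<close>

lemma cut_set_left_part:
  assumes "cut_set V E S"
  shows "cut_set V1 E1 (S \<inter> V1 - {v})"
  unfolding cut_set_def
proof (intro conjI ballI)
  let ?T = "S \<inter> V1 - {v}"
  fix i assume i: "i \<in> ?T"
  then obtain j k where jk: "(i, j) \<in> E" "(i, k) \<in> E" "j \<notin> S" "k \<notin> S" "(j, k) \<notin> reach E S"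
    using assms unfolding cut_set_def by blast
  have "i \<notin> V2" using i common by blast
  then have E1: "(i, j) \<in> E1" "(i, k) \<in> E1" using jk edges by auto
  then have jk1: "(j, k) \<notin> reach E1 S" using jk(5) reach_left_iff[of j k S] edges by blast
  have "(j, k) \<notin> reach E1 ?T"
  proof (cases "v \<in> S")
    case True
    then have "reach E1 S = reach E1 (insert v ?T)"
      using common by (intro reach_restrict[OF edges(1)]) auto
    moreover have "j \<noteq> v" "k \<noteq> v" using True jk by auto
    ultimately show ?thesis
      using jk1 reach_remove_simplicial[OF free(1) sym(1) irrefl(1), of j k ?T] by simp
  next
    case False
    then have "reach E1 S = reach E1 ?T" by (intro reach_restrict[OF edges(1)]) auto
    then show ?thesis using jk1 by simp
  qed
  then show "\<exists>j k. (i, j) \<in> E1 \<and> (i, k) \<in> E1 \<and> j \<notin> ?T \<and> k \<notin> ?T \<and> (j, k) \<notin> reach E1 ?T"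
    using E1 jk by blast
qed auto

text \<open>If \<open>v \<in> S\<close>, two neighbours of \<open>v\<close> outside \<open>S\<close> lie in different components; they are not in the same \<open>G\<^sub>i\<close>, where
  they would be adjacent. So \<open>v\<close> has a remaining neighbour in \<open>G\<^sub>1\<close>, and putting it back into \<open>G\<^sub>1\<close> does not change
  the number of components.\<close>

lemma num_components_left_part:
  assumes "cut_set V E S"
  shows "num_components V1 E1 S = num_components V1 E1 (S \<inter> V1 - {v})"
proof (cases "v \<in> S")
  case False
  then show ?thesis by (intro num_components_restrict[OF edges(1)]) auto
next
  case True
  let ?T = "S \<inter> V1 - {v}"
  obtain j k where jk: "(v, j) \<in> E" "(v, k) \<in> E" "j \<notin> S" "k \<notin> S" "(j, k) \<notin> reach E S"
    using assms True unfolding cut_set_def by blast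
  have "\<not> ((v, j) \<in> E2 \<and> (v, k) \<in> E2)"
  proof
    assume "(v, j) \<in> E2 \<and> (v, k) \<in> E2"
    then have "j = k \<or> (j, k) \<in> E" using free(2) by (auto simp: simplicial_def)
    then show False using jk reach_edge[of j k E S] by auto
  qed
  then obtain u where u: "(v, u) \<in> E1" "u \<notin> S" using jk by blast
  have "num_components V1 E1 (insert v ?T) = num_components V1 E1 ?T"
    using u edges by (intro num_components_remove_simplicial[OF free(1) sym(1) irrefl(1) u(1)]) auto
  moreover have "num_components V1 E1 S = num_components V1 E1 (insert v ?T)"
    using True common by (intro num_components_restrict[OF edges(1)]) auto
  ultimately show ?thesis by simp
qed

lemma connected_left:
  assumes "\<And>i j. i \<in> V \<Longrightarrow> j \<in> V \<Longrightarrow> (i, j) \<in> E\<^sup>*" "i \<in> V1" "j \<in> V1"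
  shows "(i, j) \<in> E1\<^sup>*"
  using assms(1)[of i j] assms(2,3) reach_left_iff[of i j "{}"] by (simp add: reach_def)

text \<open>A cut set of one side is a cut set of \<open>G\<close> that leaves the other side connected. For a cut set \<open>S\<close> of \<open>G\<close> with
  the parts \<open>T\<^sub>i = S \<inter> V\<^sub>i - {v}\<close>, the component counts of the two sides are \<open>|T\<^sub>1| + 1\<close> and \<open>|T\<^sub>2| + 1\<close>, and the loss
  of a component for \<open>v \<notin> S\<close> is matched by \<open>|S| = |T\<^sub>1| + |T\<^sub>2|\<close> instead of \<open>|T\<^sub>1| + |T\<^sub>2| + 1\<close>.\<close>

lemma balanced_gluing_iff:
  assumes one: "num_components V1 E1 {} = 1" "num_components V2 E2 {} = 1"
  shows "(\<forall>S. cut_set V E S \<longrightarrow> num_components V E S = card S + 1) \<longleftrightarrow>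
    (\<forall>S. cut_set V1 E1 S \<longrightarrow> num_components V1 E1 S = card S + 1) \<and>
    (\<forall>S. cut_set V2 E2 S \<longrightarrow> num_components V2 E2 S = card S + 1)"
proof (intro iffI conjI allI impI)
  fix S assume G: "\<forall>S. cut_set V E S \<longrightarrow> num_components V E S = card S + 1" and S: "cut_set V1 E1 S"
  have "v \<notin> S" using simplicial_not_in_cut_set[OF free(1) S] .
  moreover have "S \<inter> V2 = {}" using calculation S common by (auto simp: cut_set_def)
  then have "num_components V2 E2 S = 1"
    using num_components_restrict[OF edges(2), of S "{}"] one(2) by simp
  ultimately show "num_components V1 E1 S = card S + 1"
    using num_components_gluing[of S] G cut_set_of_left[OF S] by simp
next
  fix S assume G: "\<forall>S. cut_set V E S \<longrightarrow> num_components V E S = card S + 1" and S: "cut_set V2 E2 S"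
  have "v \<notin> S" using simplicial_not_in_cut_set[OF free(2) S] .
  moreover have "S \<inter> V1 = {}" using calculation S common by (auto simp: cut_set_def)
  then have "num_components V1 E1 S = 1"
    using num_components_restrict[OF edges(1), of S "{}"] one(1) by simp
  moreover have "cut_set V E S"
    using gluing.cut_set_of_left[OF swap S] by (simp only: Un_commute)
  ultimately show "num_components V2 E2 S = card S + 1"
    using num_components_gluing[of S] G by simp
next
  fix S
  assume G12: "(\<forall>S. cut_set V1 E1 S \<longrightarrow> num_components V1 E1 S = card S + 1) \<and>
    (\<forall>S. cut_set V2 E2 S \<longrightarrow> num_components V2 E2 S = card S + 1)" and S: "cut_set V E S"
  let ?T1 = "S \<inter> V1 - {v}" and ?T2 = "S \<inter> V2 - {v}"
  have S': "cut_set (V2 \<union> V1) (E2 \<union> E1) S" using S by (simp only: Un_commute)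
  have c1: "num_components V1 E1 S = card ?T1 + 1"
    using num_components_left_part[OF S] cut_set_left_part[OF S] G12 by simp
  have c2: "num_components V2 E2 S = card ?T2 + 1"
    using gluing.num_components_left_part[OF swap S'] gluing.cut_set_left_part[OF swap S'] G12 by simp
  have fin: "finite S" using S finite finite_subset[of S V] by (auto simp: cut_set_def)
  have "S - {v} = ?T1 \<union> ?T2" "?T1 \<inter> ?T2 = {}" using S common by (auto simp: cut_set_def)
  then have "card (S - {v}) = card ?T1 + card ?T2" using fin by (simp add: card_Un_disjoint)
  then have "card S = card ?T1 + card ?T2 + (if v \<in> S then 1 else 0)"
    using fin by (auto simp: card.remove[of S v])
  then show "num_components V E S = card S + 1"
    using num_components_gluing[of S] c1 c2 by (auto split: if_splits)
qed

end

section \<open>Free vertices and the conclusion\<close>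

lemma face_in_facet:
  assumes "finite \<Delta>" "F \<in> \<Delta>"
  shows "\<exists>F'\<in>facets \<Delta>. F \<subseteq> F'"
proof -
  obtain F' where "F' \<in> \<Delta>" "F \<subseteq> F'" "\<forall>F''\<in>\<Delta>. F' \<subseteq> F'' \<longrightarrow> F'' = F'"
    using finite_has_maximal2[OF assms] by metis
  then show ?thesis by (auto simp: facets_def)
qed

text \<open>For each neighbour \<open>w\<close> of \<open>v\<close> a facet contains the edge \<open>{v, w}\<close>; since \<open>v\<close> is free, it is the same facet for
  all \<open>w\<close>, and facets are cliques.\<close>

lemma free_vertex_simplicial:
  assumes "pair_graph G" "free_vertex (clique_complex G) v"
  shows "simplicial (parcs G) v"
  unfolding simplicial_def
proof (intro allI impI)
  interpret pair_graph G by fact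
  fix j k assume jk: "(v, j) \<in> parcs G" "(v, k) \<in> parcs G" "j \<noteq> k"
  have fin: "finite (clique_complex G)"
    by (rule finite_subset[of _ "Pow (pverts G)"]) (auto simp: clique_complex_def)
  have "\<exists>F\<in>facets (clique_complex G). {v, w} \<subseteq> F" if w: "(v, w) \<in> parcs G" for w
  proof (rule face_in_facet[OF fin])
    have "(w, v) \<in> parcs G" using w pair_sym_arcs by (auto simp: symmetric_def dest: symD)
    then show "{v, w} \<in> clique_complex G"
      using w by (auto simp: clique_complex_def dest: in_arcsD1 in_arcsD2)
  qed
  then obtain F F' where "F \<in> facets (clique_complex G)" "{v, j} \<subseteq> F"
    "F' \<in> facets (clique_complex G)" "{v, k} \<subseteq> F'" using jk by meson
  moreover from this have "F = F'" using assms(2) by (auto simp: free_vertex_def)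
  ultimately have "F \<in> clique_complex G" "j \<in> F" "k \<in> F" by (auto simp: facets_def)
  then show "(j, k) \<in> parcs G" using jk(3) by (auto simp: clique_complex_def)
qed

lemma pair_graph_edges:
  assumes "pair_graph G"
  shows "finite (pverts G)" "parcs G \<subseteq> pverts G \<times> pverts G" "sym (parcs G)" "irrefl (parcs G)"
proof -
  interpret pair_graph G by fact
  show "finite (pverts G)" "parcs G \<subseteq> pverts G \<times> pverts G" by (auto dest: in_arcsD1 in_arcsD2)
  show "sym (parcs G)" using pair_sym_arcs by (simp add: symmetric_def)
  show "irrefl (parcs G)" using pair_no_loops by (fastforce simp: irrefl_def)
qed

lemma connected_reach:
  assumes "pair_graph G" "connected (with_proj G)"
  shows "i \<in> pverts G \<Longrightarrow> j \<in> pverts G \<Longrightarrow> (i, j) \<in> (parcs G)\<^sup>*"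
proof -
  interpret pair_graph G by fact
  have "strongly_connected (with_proj G)"
    using symmetric_connected_imp_strongly_connected[OF pair_sym_arcs assms(2)] .
  then show "i \<in> pverts G \<Longrightarrow> j \<in> pverts G \<Longrightarrow> (i, j) \<in> (parcs G)\<^sup>*"
    by (auto simp: strongly_connected_def reachable_def dest: rtrancl_on_rtranclI)
qed

lemma unmixed_binomial_edge_ideal_iff:
  fixes G :: "('v :: linorder) pair_pre_digraph"
  assumes "pair_graph G" "pverts G \<noteq> {}" "\<And>i j. i \<in> pverts G \<Longrightarrow> j \<in> pverts G \<Longrightarrow> (i, j) \<in> (parcs G)\<^sup>*"
  shows "unmixed (edge_ring G) (binomial_edge_ideal G :: ('v edge_var, 'k :: field) mpoly set) \<longleftrightarrow>
    (\<forall>S. cut_set (pverts G) (parcs G) S \<longrightarrow> num_components (pverts G) (parcs G) S = card S + 1)"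
  unfolding binomial_edge_ideal_eq[OF assms(1)]
  using pair_graph_edges[OF assms(1)] assms(2,3) by (intro unmixed_edge_ideal_iff)

theorem proposition2p6:
  fixes G G1 G2 :: "('v :: linorder) pair_pre_digraph" and v :: 'v
  assumes "pair_graph G" and "pair_graph G1" and "pair_graph G2"
    and "connected (with_proj G)"
    and "with_proj G = union (with_proj G1) (with_proj G2)"
    and "pverts G1 \<inter> pverts G2 = {v}"
    and "free_vertex (clique_complex G1) v"
    and "free_vertex (clique_complex G2) v"
  shows "unmixed (edge_ring G) (binomial_edge_ideal G :: ('v edge_var, 'k :: field) mpoly set) \<longleftrightarrow>
      unmixed (edge_ring G1) (binomial_edge_ideal G1 :: ('v edge_var, 'k) mpoly set) \<and>
      unmixed (edge_ring G2) (binomial_edge_ideal G2 :: ('v edge_var, 'k) mpoly set)"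
proof -
  have G: "pverts G = pverts G1 \<union> pverts G2" "parcs G = parcs G1 \<union> parcs G2"
    using arg_cong[OF assms(5), of verts] arg_cong[OF assms(5), of arcs] by simp_all
  interpret gluing "pverts G1" "pverts G2" "parcs G1" "parcs G2" v
    using pair_graph_edges[OF assms(2)] pair_graph_edges[OF assms(3)] assms(6)
      free_vertex_simplicial[OF assms(2,7)] free_vertex_simplicial[OF assms(3,8)]
    by unfold_locales
  have conn: "(i, j) \<in> (parcs G1 \<union> parcs G2)\<^sup>*"
    if "i \<in> pverts G1 \<union> pverts G2" "j \<in> pverts G1 \<union> pverts G2" for i j
    using connected_reach[OF assms(1,4), of i j] that unfolding G .
  have conn1: "(i, j) \<in> (parcs G1)\<^sup>*" if "i \<in> pverts G1" "j \<in> pverts G1" for i j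
    using connected_left[OF conn that] .
  have conn2: "(i, j) \<in> (parcs G2)\<^sup>*" if "i \<in> pverts G2" "j \<in> pverts G2" for i j
    using gluing.connected_left[OF swap _ that] conn by (simp only: Un_commute)
  have v: "v \<in> pverts G1" "v \<in> pverts G2" using assms(6) by auto
  have ne: "pverts G \<noteq> {}" "pverts G1 \<noteq> {}" "pverts G2 \<noteq> {}" using v G by auto
  have "num_components (pverts G1) (parcs G1) {} = 1" "num_components (pverts G2) (parcs G2) {} = 1"
    using num_components_empty[OF ne(2) conn1 sym(1)] num_components_empty[OF ne(3) conn2 sym(2)] by auto
  note balanced = balanced_gluing_iff[OF this]
  have "unmixed (edge_ring G) (binomial_edge_ideal G :: ('v edge_var, 'k) mpoly set) \<longleftrightarrow>
      (\<forall>S. cut_set V E S \<longrightarrow> num_components V E S = card S + 1)"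
    unfolding G[symmetric] using assms(1) ne(1) connected_reach[OF assms(1,4)]
    by (rule unmixed_binomial_edge_ideal_iff)
  moreover have "unmixed (edge_ring G1) (binomial_edge_ideal G1 :: ('v edge_var, 'k) mpoly set) \<longleftrightarrow>
      (\<forall>S. cut_set (pverts G1) (parcs G1) S \<longrightarrow> num_components (pverts G1) (parcs G1) S = card S + 1)"
    using assms(2) ne(2) conn1 by (rule unmixed_binomial_edge_ideal_iff)
  moreover have "unmixed (edge_ring G2) (binomial_edge_ideal G2 :: ('v edge_var, 'k) mpoly set) \<longleftrightarrow>
      (\<forall>S. cut_set (pverts G2) (parcs G2) S \<longrightarrow> num_components (pverts G2) (parcs G2) S = card S + 1)"
    using assms(3) ne(3) conn2 by (rule unmixed_binomial_edge_ideal_iff)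
  ultimately show ?thesis using balanced by (simp only:)
qed

end
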